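(* Let $(D,\Sigma)$ be a strongly recursive tropical linear series of rank $r$ on a metric graph $\Gamma$. Then for every effective divisor $E$ on $\Gamma$ with $\deg E=r$ there exists $f\in\Sigma$ such that $\mathrm{div}(f)+D\ge E$ and $\rho_v(f)\ge E(v)$ for all $v\in\Gamma$.
   Context: Metric graphs and functions. A metric graph is obtained from a finite connected graph by identifying each edge with a closed interval of positive length. $T_v(\Gamma)$ is the set of outgoing tangent directions. $\mathrm{sl}_\eta(f)$ is the outgoing slope of a continuous piecewise linear integer-slope function $f$. We set $\mathrm{div}(f)=\sum_v(-\sum_{\eta\in T_v}\mathrm{sl}_\eta(f))v$ and $R(D)=\{f:D+\mathrm{div}(f)\ge0\}$. Tropical linear series. A tropical linear series of rank $r$ is $(D,\Sigma)$ with $\Sigma\subseteq R(D)$ a finitely generated tropical submodule (closed under $\min\{f_i+a_i\}$, $a_i\in\mathbb R$) such that: (1) every effective $E$ of degree $r$ admits $f\in\Sigma$ with $\mathrm{div}(f)+D\ge E$; (2) every $r+2$ functions are tropically dependent (some $\min_i(f_i+a_i)$ is attained at least twice at every point). It is strongly recursive (recursively in $r$) if: (3) every $r$ functions lie in a strongly recursive subseries of rank $r-1$; (4) for $S_1,S_2\subseteq\Sigma$ of sizes $s_1,s_2\le r$ with $s_1+s_2\ge r+2$, there are strongly recursive subseries $\Sigma_i\supseteq S_i$ of ranks $s_i-1$ whose intersection contains a strongly recursive series of rank $s_1+s_2-r-2$. Local arrays. Each slope set $\{\mathrm{sl}_\eta(f):f\in\Sigma\}$ has exactly $r+1$ elements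 $s_\eta[0]<\dots<s_\eta[r]$. Fix at each $v$ of valence $d$ an ordering $\eta_1,\dots,\eta_d$ of $T_v(\Gamma)$. The local array is $M_v=\{\mathbf x\in[r]^d:\exists f\in\Sigma,\ \mathrm{sl}_{\eta_i}(f)=s_{\eta_i}[x_i]\ \forall i\}$, where $[r]=\{0,\dots,r\}$; $\mathbf x$ and $f$ are then associated. Permutation arrays. $P\subseteq[r]^d$ is rankable of rank $s$ if each coordinate takes exactly $s+1$ distinct values on $P$. It is totally rankable if every $P[\mathbf x]=\{\mathbf y\in P:\mathbf y\succeq\mathbf x\}$ (coordinatewise order) is rankable, with rank array $\rho_P(\mathbf x)=\mathrm{rank}\,P[\mathbf x]$. A point is redundant if it is the coordinatewise minimum of at least two elements of $P$ each sharing a coordinate with it. A permutation array of rank $r$ is a totally rankable $P$ of rank $r$ with no redundant points, and $\overline P$ adds the redundant points. For a strongly recursive tropical linear series each $M_v=\overline{P_v}$ for a unique permutation array $P_v$ of rank $r$ and dimension $\mathrm{val}(v)$. Local rank. For $f\in\Sigma$ associated to $\mathbf x\in M_v$, $\rho_v(f)=\rho_{P_v}(\mathbf x)$. *)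

theory Defs
  imports "HOL-Analysis.Analysis"
begin

section \<open>Metric graphs\<close>

text \<open>A metric graph is given by a finite connected combinatorial model: vertices, edges
 (loops and multiple edges allowed), endpoint maps and positive edge lengths.
 Edge e is identified with the interval [0, len e], 0 corresponding to src e and
 len e to tgt e.\<close>

record ('v, 'e) mgraph =
  verts :: "'v set"
  edges :: "'e set"
  src :: "'e \<Rightarrow> 'v"
  tgt :: "'e \<Rightarrow> 'v"
  len :: "'e \<Rightarrow> real"

definition metric_graph :: "('v, 'e) mgraph \<Rightarrow> bool" where
  "metric_graph G \<longleftrightarrow>
     finite (verts G) \<and> finite (edges G) \<and> verts G \<noteq> {} \<and>
     (\<forall>e\<in>edges G. src G e \<in> verts G \<and> tgt G e \<in> verts G \<and> len G e > 0) \<and>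
     (\<forall>u\<in>verts G. \<forall>w\<in>verts G.
        (u, w) \<in> ({(src G e, tgt G e) | e. e \<in> edges G} \<union>
                  {(tgt G e, src G e) | e. e \<in> edges G})\<^sup>*)"

text \<open>Points of the metric graph: vertices, and interior points of edges.\<close>

datatype ('v, 'e) point = Vtx 'v | Inn 'e real

definition pts :: "('v, 'e) mgraph \<Rightarrow> ('v, 'e) point set" where
  "pts G = Vtx ` verts G \<union> {Inn e t | e t. e \<in> edges G \<and> 0 < t \<and> t < len G e}"

text \<open>The point of edge e at parameter t (0 \<le> t \<le> len e).\<close>

definition edge_pt :: "('v, 'e) mgraph \<Rightarrow> 'e \<Rightarrow> real \<Rightarrow> ('v, 'e) point" where
  "edge_pt G e t = (if t = 0 then Vtx (src G e) else if t = len G e then Vtx (tgt G e) else Inn e t)"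

definition fe :: "('v, 'e) mgraph \<Rightarrow> (('v, 'e) point \<Rightarrow> real) \<Rightarrow> 'e \<Rightarrow> real \<Rightarrow> real" where
  "fe G f e t = f (edge_pt G e t)"

text \<open>Tangent directions: Dir e t b is the direction at parameter t of edge e,
 pointing towards increasing parameter (b = True) or decreasing parameter (b = False).\<close>

datatype 'e tdir = Dir 'e real bool

definition tdirs :: "('v, 'e) mgraph \<Rightarrow> ('v, 'e) point \<Rightarrow> 'e tdir set" where
  "tdirs G p = (case p of
      Vtx v \<Rightarrow> {Dir e 0 True | e. e \<in> edges G \<and> src G e = v} \<union>
               {Dir e (len G e) False | e. e \<in> edges G \<and> tgt G e = v}
    | Inn e t \<Rightarrow> {Dir e t True, Dir e t False})"

definition valence :: "('v, 'e) mgraph \<Rightarrow> ('v, 'e) point \<Rightarrow> nat" where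
  "valence G p = card (tdirs G p)"

section \<open>Piecewise linear functions, slopes, divisors\<close>

text \<open>Functions on the metric graph are functions on points, taken to be 0 off the graph
 (so that equality of functions means equality on the graph).\<close>

definition pl_fun :: "('v, 'e) mgraph \<Rightarrow> (('v, 'e) point \<Rightarrow> real) \<Rightarrow> bool" where
  "pl_fun G f \<longleftrightarrow>
     (\<forall>p. p \<notin> pts G \<longrightarrow> f p = 0) \<and>
     (\<forall>e\<in>edges G. \<exists>xs :: real list.
        sorted_wrt (<) xs \<and> 2 \<le> length xs \<and> hd xs = 0 \<and> last xs = len G e \<and>
        (\<forall>i. Suc i < length xs \<longrightarrow>
           (\<exists>m :: int. \<exists>c :: real. \<forall>t\<in>{xs ! i .. xs ! Suc i}. fe G f e t = of_int m * t + c)))"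

text \<open>Outgoing slope of f along a tangent direction.\<close>

definition sl :: "('v, 'e) mgraph \<Rightarrow> (('v, 'e) point \<Rightarrow> real) \<Rightarrow> 'e tdir \<Rightarrow> real" where
  "sl G f d = (case d of Dir e t b \<Rightarrow>
      Lim (at_right 0) (\<lambda>h. (fe G f e (if b then t + h else t - h) - fe G f e t) / h))"

definition divf :: "('v, 'e) mgraph \<Rightarrow> (('v, 'e) point \<Rightarrow> real) \<Rightarrow> ('v, 'e) point \<Rightarrow> real" where
  "divf G f p = (if p \<in> pts G then - (\<Sum>d\<in>tdirs G p. sl G f d) else 0)"

definition divisor :: "('v, 'e) mgraph \<Rightarrow> (('v, 'e) point \<Rightarrow> int) \<Rightarrow> bool" where
  "divisor G E \<longleftrightarrow> finite {p. E p \<noteq> 0} \<and> {p. E p \<noteq> 0} \<subseteq> pts G"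

definition effective :: "('v, 'e) mgraph \<Rightarrow> (('v, 'e) point \<Rightarrow> int) \<Rightarrow> bool" where
  "effective G E \<longleftrightarrow> divisor G E \<and> (\<forall>p. E p \<ge> 0)"

definition deg :: "(('v, 'e) point \<Rightarrow> int) \<Rightarrow> int" where
  "deg E = (\<Sum>p\<in>{p. E p \<noteq> 0}. E p)"

text \<open>R(D) = {f : D + div f \<ge> 0}.\<close>

definition RD :: "('v, 'e) mgraph \<Rightarrow> (('v, 'e) point \<Rightarrow> int) \<Rightarrow> (('v, 'e) point \<Rightarrow> real) set" where
  "RD G D = {f. pl_fun G f \<and> (\<forall>p\<in>pts G. of_int (D p) + divf G f p \<ge> 0)}"

section \<open>Tropical linear series\<close>

text \<open>Tropical span of a finite set of functions: all min_{g\<in>H} (g + a_g), H nonempty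
 (coefficients +\<infinity> correspond to omitting generators).\<close>

definition tspan :: "('v, 'e) mgraph \<Rightarrow> (('v, 'e) point \<Rightarrow> real) set \<Rightarrow> (('v, 'e) point \<Rightarrow> real) set" where
  "tspan G S = {(\<lambda>p. if p \<in> pts G then Min ((\<lambda>g. g p + a g) ` H) else 0) | H a.
                  H \<subseteq> S \<and> H \<noteq> {}}"

definition fg_module :: "('v, 'e) mgraph \<Rightarrow> (('v, 'e) point \<Rightarrow> real) set \<Rightarrow> bool" where
  "fg_module G \<Sigma> \<longleftrightarrow> (\<exists>S. finite S \<and> \<Sigma> = tspan G S)"

definition trop_dep :: "('v, 'e) mgraph \<Rightarrow> (('v, 'e) point \<Rightarrow> real) set \<Rightarrow> bool" where
  "trop_dep G F \<longleftrightarrow> (\<exists>a :: (('v, 'e) point \<Rightarrow> real) \<Rightarrow> real. \<forall>p\<in>pts G.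
      \<exists>f\<in>F. \<exists>g\<in>F. f \<noteq> g \<and>
        f p + a f = Min ((\<lambda>h. h p + a h) ` F) \<and> g p + a g = Min ((\<lambda>h. h p + a h) ` F))"

text \<open>Tropical linear series (D, \<Sigma>) of rank r (r \<ge> -1; rank -1 is used as the base of
 the recursion in the definition of strongly recursive series).\<close>

definition tls :: "('v, 'e) mgraph \<Rightarrow> (('v, 'e) point \<Rightarrow> int) \<Rightarrow> int \<Rightarrow> (('v, 'e) point \<Rightarrow> real) set \<Rightarrow> bool" where
  "tls G D r \<Sigma> \<longleftrightarrow>
     fg_module G \<Sigma> \<and> \<Sigma> \<subseteq> RD G D \<and>
     (\<forall>E. effective G E \<and> deg E = r \<longrightarrow>
        (\<exists>f\<in>\<Sigma>. \<forall>p\<in>pts G. of_int (D p) + divf G f p \<ge> of_int (E p))) \<and>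
     (\<forall>F. F \<subseteq> \<Sigma> \<and> finite F \<and> int (card F) = r + 2 \<longrightarrow> trop_dep G F)"

text \<open>srl G D k j \<Sigma>, for j \<le> k, says that (D, \<Sigma>) is a strongly recursive tropical linear
 series of rank j - 1.  (Conditions (3) and (4), recursively in the rank.)\<close>

primrec srl :: "('v, 'e) mgraph \<Rightarrow> (('v, 'e) point \<Rightarrow> int) \<Rightarrow> nat \<Rightarrow> nat \<Rightarrow>
                (('v, 'e) point \<Rightarrow> real) set \<Rightarrow> bool" where
  "srl G D 0 j \<Sigma> = (j = 0 \<and> tls G D (-1) \<Sigma>)"
| "srl G D (Suc k) j \<Sigma> =
     (if j \<le> k then srl G D k j \<Sigma>
      else j = Suc k \<and> tls G D (int k) \<Sigma> \<and>
        \<comment> \<open>(3): every k functions lie in a strongly recursive subseries of rank k - 1\<close>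
        (\<forall>S. S \<subseteq> \<Sigma> \<and> finite S \<and> card S = k \<longrightarrow>
           (\<exists>\<Sigma>'. \<Sigma>' \<subseteq> \<Sigma> \<and> S \<subseteq> \<Sigma>' \<and> srl G D k k \<Sigma>')) \<and>
        \<comment> \<open>(4)\<close>
        (\<forall>S1 S2. S1 \<subseteq> \<Sigma> \<and> S2 \<subseteq> \<Sigma> \<and> finite S1 \<and> finite S2 \<and>
            card S1 \<le> k \<and> card S2 \<le> k \<and> card S1 + card S2 \<ge> k + 2 \<longrightarrow>
           (\<exists>\<Sigma>1 \<Sigma>2 \<Sigma>3. \<Sigma>1 \<subseteq> \<Sigma> \<and> \<Sigma>2 \<subseteq> \<Sigma> \<and> S1 \<subseteq> \<Sigma>1 \<and> S2 \<subseteq> \<Sigma>2 \<and>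
              srl G D k (card S1) \<Sigma>1 \<and> srl G D k (card S2) \<Sigma>2 \<and>
              \<Sigma>3 \<subseteq> \<Sigma>1 \<inter> \<Sigma>2 \<and> srl G D k (card S1 + card S2 - k - 1) \<Sigma>3)))"

definition strongly_recursive ::
  "('v, 'e) mgraph \<Rightarrow> (('v, 'e) point \<Rightarrow> int) \<Rightarrow> int \<Rightarrow> (('v, 'e) point \<Rightarrow> real) set \<Rightarrow> bool" where
  "strongly_recursive G D r \<Sigma> \<longleftrightarrow> r \<ge> -1 \<and> srl G D (nat (r + 1)) (nat (r + 1)) \<Sigma>"

section \<open>Permutation arrays\<close>

text \<open>Points of [r]^d are lists of length d with entries in {0..r}.\<close>

definition cube :: "nat \<Rightarrow> nat \<Rightarrow> nat list set" where
  "cube r d = {x. length x = d \<and> set x \<subseteq> {0..r}}"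

definition leq_vec :: "nat list \<Rightarrow> nat list \<Rightarrow> bool" where
  "leq_vec x y \<longleftrightarrow> list_all2 (\<le>) x y"

definition upset :: "nat list set \<Rightarrow> nat list \<Rightarrow> nat list set" where
  "upset P x = {y\<in>P. leq_vec x y}"

text \<open>Rankable of rank s: each coordinate takes exactly s+1 values (empty set: rank -1).\<close>

definition rankable :: "nat \<Rightarrow> nat list set \<Rightarrow> int \<Rightarrow> bool" where
  "rankable d P s \<longleftrightarrow> (\<forall>i<d. int (card ((\<lambda>x. x ! i) ` P)) = s + 1)"

definition arr_rank :: "nat \<Rightarrow> nat list set \<Rightarrow> int" where
  "arr_rank d P = (THE s. rankable d P s)"

definition totally_rankable :: "nat \<Rightarrow> nat \<Rightarrow> nat list set \<Rightarrow> bool" where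
  "totally_rankable r d P \<longleftrightarrow> (\<forall>x\<in>cube r d. \<exists>s. rankable d (upset P x) s)"

definition rank_array :: "nat \<Rightarrow> nat list set \<Rightarrow> nat list \<Rightarrow> int" where
  "rank_array d P x = arr_rank d (upset P x)"

definition vmin :: "nat list set \<Rightarrow> nat list" where
  "vmin S = map (\<lambda>i. Min ((\<lambda>y. y ! i) ` S)) [0..<length (SOME y. y \<in> S)]"

definition redundant :: "nat \<Rightarrow> nat list set \<Rightarrow> nat list \<Rightarrow> bool" where
  "redundant d P x \<longleftrightarrow> (\<exists>S. S \<subseteq> P \<and> finite S \<and> card S \<ge> 2 \<and> x \<notin> S \<and> vmin S = x \<and>
                               (\<forall>y\<in>S. \<exists>i<d. y ! i = x ! i))"

definition perm_array :: "nat \<Rightarrow> nat \<Rightarrow> nat list set \<Rightarrow> bool" where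
  "perm_array r d P \<longleftrightarrow> P \<subseteq> cube r d \<and> totally_rankable r d P \<and> arr_rank d P = int r \<and>
                         (\<forall>x\<in>P. \<not> redundant d P x)"

definition closure_arr :: "nat \<Rightarrow> nat \<Rightarrow> nat list set \<Rightarrow> nat list set" where
  "closure_arr r d P = P \<union> {x\<in>cube r d. redundant d P x}"

section \<open>Local arrays and local rank\<close>

text \<open>ord p is the fixed ordering of the tangent directions at p.\<close>

definition slopes :: "('v, 'e) mgraph \<Rightarrow> (('v, 'e) point \<Rightarrow> real) set \<Rightarrow> 'e tdir \<Rightarrow> real list" where
  "slopes G \<Sigma> d = sorted_list_of_set ((\<lambda>f. sl G f d) ` \<Sigma>)"

definition assoc :: "('v, 'e) mgraph \<Rightarrow> (('v, 'e) point \<Rightarrow> real) set \<Rightarrow> nat \<Rightarrow>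
     (('v, 'e) point \<Rightarrow> 'e tdir list) \<Rightarrow> ('v, 'e) point \<Rightarrow> nat list \<Rightarrow> (('v, 'e) point \<Rightarrow> real) \<Rightarrow> bool" where
  "assoc G \<Sigma> r ord p x f \<longleftrightarrow> x \<in> cube r (length (ord p)) \<and> f \<in> \<Sigma> \<and>
      (\<forall>i<length (ord p). sl G f (ord p ! i) = slopes G \<Sigma> (ord p ! i) ! (x ! i))"

definition local_array :: "('v, 'e) mgraph \<Rightarrow> (('v, 'e) point \<Rightarrow> real) set \<Rightarrow> nat \<Rightarrow>
     (('v, 'e) point \<Rightarrow> 'e tdir list) \<Rightarrow> ('v, 'e) point \<Rightarrow> nat list set" where
  "local_array G \<Sigma> r ord p = {x. \<exists>f. assoc G \<Sigma> r ord p x f}"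

definition local_perm_array :: "('v, 'e) mgraph \<Rightarrow> (('v, 'e) point \<Rightarrow> real) set \<Rightarrow> nat \<Rightarrow>
     (('v, 'e) point \<Rightarrow> 'e tdir list) \<Rightarrow> ('v, 'e) point \<Rightarrow> nat list set" where
  "local_perm_array G \<Sigma> r ord p =
     (THE P. perm_array r (valence G p) P \<and> local_array G \<Sigma> r ord p = closure_arr r (valence G p) P)"

definition local_rank :: "('v, 'e) mgraph \<Rightarrow> (('v, 'e) point \<Rightarrow> real) set \<Rightarrow> nat \<Rightarrow>
     (('v, 'e) point \<Rightarrow> 'e tdir list) \<Rightarrow> ('v, 'e) point \<Rightarrow> (('v, 'e) point \<Rightarrow> real) \<Rightarrow> int" where
  "local_rank G \<Sigma> r ord p f =
     rank_array (valence G p) (local_perm_array G \<Sigma> r ord p) (THE x. assoc G \<Sigma> r ord p x f)"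

end

theory Submission
  imports Defs
begin

text \<open>Spread each \<open>E(v)\<close> over distinct points on a short germ at \<open>v\<close>. Condition (1) gives functions
  \<open>f\<^sub>n \<in> \<Sigma>\<close> that bend at all these points, so near \<open>v\<close> at least \<open>E(v) + 1\<close> generators of
  distinct slopes attain the minimum defining \<open>f\<^sub>n\<close>. The coefficients can be kept bounded, and for a
  limit \<open>f\<close> of the \<open>f\<^sub>n\<close> these generators attain the minimum at \<open>v\<close> itself; their slopes
  there are at least those of \<open>f\<close> in every direction. Now the functions of \<open>\<Sigma>\<close> whose slopes at
  \<open>v\<close> dominate those of \<open>f\<close> have \<open>\<rho>\<^sub>v(f) + 1\<close> distinct slopes in each direction, which
  gives \<open>\<rho>\<^sub>v(f) \<ge> E(v)\<close>. Finally \<open>D(v) + div(f)(v) \<ge> \<rho>\<^sub>v(f)\<close>: by condition (3) one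
  descends to a subseries of rank \<open>\<rho>\<^sub>v(f)\<close>, in which \<open>f\<close> has minimal slopes at \<open>v\<close>, and
  compares \<open>f\<close> with a function provided by condition (1).\<close>

section \<open>Germs of edges\<close>

text \<open>Condition (1) for \<open>E\<close> itself yields the divisor inequality, but gives no
  hold on how many slopes of \<Sigma> lie above those of the function at a point. Distinct nearby
  points give that hold: off the support of \<open>D\<close>, a function with D + div \<ge> 1 has a
  strictly concave kink, so along the germ the slopes of its minimising generators drop at each of
  the chosen points. The inequality for \<open>E\<close> is not carried through the limit; it is
  recovered at the end from the slope count. The limit uses only that a generator strictly above the
  minimum at v stays so on a short germ for nearby coefficients. Local rank is defined through a
  uniquely determined array. In the analysis it is replaced by a count: the slopes, along one
  direction, of the functions dominating \<open>f\<close>. That the count does not depend on the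
  direction is the total rankability of \<open>M_v\<close>. It rests on tropical dependence: once
  the dominating functions have as many slopes along one direction as all of \<Sigma> can have,
  every function of \<Sigma> is forced to dominate.\<close>

definition germ_pt :: "('v, 'e) mgraph \<Rightarrow> 'e tdir \<Rightarrow> real \<Rightarrow> ('v, 'e) point" where
  "germ_pt G d h = (case d of Dir e t b \<Rightarrow> edge_pt G e (if b then t + h else t - h))"

lemma eventually_at_right_0_less: "\<forall>\<^sub>F h in at_right 0. h < c" if "0 < c" for c :: real
  using eventually_at_right_real[OF that] by (rule eventually_mono) auto

lemma eventually_at_right_0_pos: "\<forall>\<^sub>F h in at_right 0. 0 < (h :: real)"
  by (simp add: eventually_at_filter)

text \<open>Lexicographic comparison of (value, slope). The equivalence, rather than one
  implication, is what turns \<open>active_along\<close> into an equation of sets.\<close>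

lemma eventually_lines_le_iff:
  fixes a b s t :: real
  shows "\<forall>\<^sub>F h in at_right 0. (a + s * h \<le> b + t * h \<longleftrightarrow> a < b \<or> a = b \<and> s \<le> t)"
proof -
  have lt: "\<forall>\<^sub>F h in at_right 0. a + s * h < b + t * h" if "a < b" for a b s t :: real
  proof -
    have "((\<lambda>h. a + s * h) \<longlongrightarrow> a + s * 0) (at_right 0)" "((\<lambda>h. b + t * h) \<longlongrightarrow> b + t * 0) (at_right 0)"
      by (intro tendsto_intros)+
    then show ?thesis
      using order_tendstoD(2)[of "\<lambda>h. (a + s * h) - (b + t * h)" "a - b" "at_right 0" 0] that
      by (force dest: tendsto_diff elim: eventually_mono)
  qed
  consider "a < b" | "b < a" | "a = b" by linarith
  then show ?thesis
  proof cases
    case 1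
    show ?thesis by (rule eventually_mono[OF lt[OF 1, of s t]]) (use 1 in auto)
  next
    case 2
    show ?thesis by (rule eventually_mono[OF lt[OF 2, of t s]]) (use 2 in auto)
  next
    case 3
    show ?thesis by (rule eventually_mono[OF eventually_at_right_0_pos]) (use 3 in auto)
  qed
qed

lemma sl_eq_Lim_germ:
  "sl G f d = Lim (at_right 0) (\<lambda>h. (f (germ_pt G d h) - f (germ_pt G d 0)) / h)"
  by (cases d) (simp add: sl_def germ_pt_def fe_def if_distrib cong: if_cong)

lemma sl_eqI:
  assumes "\<forall>\<^sub>F h in at_right 0. f (germ_pt G d h) = f (germ_pt G d 0) + m * h"
  shows "sl G f d = m"
proof -
  have "\<forall>\<^sub>F h in at_right 0. (f (germ_pt G d h) - f (germ_pt G d 0)) / h = m"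
    using assms eventually_at_right_0_pos by eventually_elim auto
  then have "((\<lambda>h. (f (germ_pt G d h) - f (germ_pt G d 0)) / h) \<longlongrightarrow> m) (at_right 0)"
    by (rule tendsto_eventually)
  then show ?thesis
    unfolding sl_eq_Lim_germ by (intro tendsto_Lim) auto
qed

lemma tdirs_cases:
  assumes "metric_graph G" "p \<in> pts G" "d \<in> tdirs G p"
  obtains (fwd) e t where "d = Dir e t True" "e \<in> edges G" "0 \<le> t" "t < len G e" "edge_pt G e t = p"
  | (bwd) e t where "d = Dir e t False" "e \<in> edges G" "0 < t" "t \<le> len G e" "edge_pt G e t = p"
  using assms unfolding metric_graph_def tdirs_def pts_def edge_pt_def
  by (auto split: point.splits)

lemma germ_pt_0:
  assumes "metric_graph G" "p \<in> pts G" "d \<in> tdirs G p"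
  shows "germ_pt G d 0 = p"
  using assms by (cases rule: tdirs_cases) (auto simp: germ_pt_def)

text \<open>Two half-open versions are needed: at a breakpoint, a forward germ runs in the piece
  that starts there and a backward germ in the piece that ends there.\<close>

lemma sorted_list_interval:
  fixes xs :: "real list"
  assumes "2 \<le> length xs" "sorted_wrt (<) xs" "hd xs \<le> t" "t < last xs"
  shows "\<exists>i. Suc i < length xs \<and> xs ! i \<le> t \<and> t < xs ! Suc i"
  using assms
proof (induction xs)
  case (Cons x xs)
  then obtain y ys where xs: "xs = y # ys" by (cases xs) auto
  show ?case
  proof (cases "t < y")
    case True
    then show ?thesis using Cons xs by (intro exI[of _ 0]) auto
  next
    case False
    then have "ys \<noteq> []" using Cons xs by auto
    then have "\<exists>i. Suc i < length xs \<and> xs ! i \<le> t \<and> t < xs ! Suc i"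
      using Cons xs False by (intro Cons.IH) (auto simp: Suc_le_eq)
    then obtain i where "Suc i < length xs" "xs ! i \<le> t" "t < xs ! Suc i" by blast
    then show ?thesis by (intro exI[of _ "Suc i"]) auto
  qed
qed auto

lemma sorted_list_interval':
  fixes xs :: "real list"
  assumes "2 \<le> length xs" "sorted_wrt (<) xs" "hd xs < t" "t \<le> last xs"
  shows "\<exists>i. Suc i < length xs \<and> xs ! i < t \<and> t \<le> xs ! Suc i"
  using assms
proof (induction xs)
  case (Cons x xs)
  then obtain y ys where xs: "xs = y # ys" by (cases xs) auto
  show ?case
  proof (cases "t \<le> y")
    case True
    then show ?thesis using Cons xs by (intro exI[of _ 0]) auto
  next
    case False
    then have "ys \<noteq> []" using Cons xs by auto
    then have "\<exists>i. Suc i < length xs \<and> xs ! i < t \<and> t \<le> xs ! Suc i"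
      using Cons xs False by (intro Cons.IH) (auto simp: Suc_le_eq)
    then obtain i where "Suc i < length xs" "xs ! i < t" "t \<le> xs ! Suc i" by blast
    then show ?thesis by (intro exI[of _ "Suc i"]) auto
  qed
qed auto

lemma pl_funE:
  assumes "pl_fun G f" "e \<in> edges G"
  obtains xs where "sorted_wrt (<) xs" "2 \<le> length xs" "hd xs = 0" "last xs = len G e"
    "\<And>i. Suc i < length xs \<Longrightarrow>
      \<exists>m :: int. \<exists>c :: real. \<forall>t\<in>{xs ! i .. xs ! Suc i}. fe G f e t = of_int m * t + c"
proof -
  have "\<forall>e\<in>edges G. \<exists>xs :: real list.
        sorted_wrt (<) xs \<and> 2 \<le> length xs \<and> hd xs = 0 \<and> last xs = len G e \<and>
        (\<forall>i. Suc i < length xs \<longrightarrow>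
           (\<exists>m :: int. \<exists>c :: real. \<forall>t\<in>{xs ! i .. xs ! Suc i}. fe G f e t = of_int m * t + c))"
    using assms(1) unfolding pl_fun_def by (rule conjunct2)
  from bspec[OF this assms(2)] show ?thesis using that by (elim exE conjE) metis
qed

text \<open>\<open>sl\<close> is a \<open>Lim\<close>, hence meaningful only once the limit exists.
  On the linear piece at the start of the germ the difference quotient is constant, so
  \<open>sl\<close> is the true slope.\<close>

lemma pl_fun_germ:
  assumes G: "metric_graph G" and f: "pl_fun G f" and p: "p \<in> pts G" and d: "d \<in> tdirs G p"
  shows "\<forall>\<^sub>F h in at_right 0. f (germ_pt G d h) = f p + sl G f d * h"
proof -
  have "\<exists>m. \<forall>\<^sub>F h in at_right 0. f (germ_pt G d h) = f (germ_pt G d 0) + m * h"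
    using G p d
  proof (cases rule: tdirs_cases)
    case (fwd e t)
    obtain xs where xs: "sorted_wrt (<) xs" "2 \<le> length xs" "hd xs = 0" "last xs = len G e"
      "\<And>i. Suc i < length xs \<Longrightarrow>
        \<exists>m :: int. \<exists>c :: real. \<forall>t\<in>{xs ! i .. xs ! Suc i}. fe G f e t = of_int m * t + c"
      using pl_funE[OF f fwd(2)] by metis
    obtain i where i: "Suc i < length xs" "xs ! i \<le> t" "t < xs ! Suc i"
      using sorted_list_interval[of xs t] xs fwd by auto
    obtain m :: int and c where mc: "\<And>t. xs ! i \<le> t \<Longrightarrow> t \<le> xs ! Suc i \<Longrightarrow> f (edge_pt G e t) = of_int m * t + c"
      using xs(5)[OF i(1)] by (auto simp: fe_def)
    have "\<forall>\<^sub>F h in at_right 0. h < xs ! Suc i - t"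
      using i by (intro eventually_at_right_0_less) auto
    then have "\<forall>\<^sub>F h in at_right 0. f (germ_pt G d h) = f (germ_pt G d 0) + of_int m * h"
      using eventually_at_right_0_pos
      by eventually_elim (use fwd(1-4) i in \<open>simp add: germ_pt_def mc algebra_simps\<close>)
    then show ?thesis by blast
  next
    case (bwd e t)
    obtain xs where xs: "sorted_wrt (<) xs" "2 \<le> length xs" "hd xs = 0" "last xs = len G e"
      "\<And>i. Suc i < length xs \<Longrightarrow>
        \<exists>m :: int. \<exists>c :: real. \<forall>t\<in>{xs ! i .. xs ! Suc i}. fe G f e t = of_int m * t + c"
      using pl_funE[OF f bwd(2)] by metis
    obtain i where i: "Suc i < length xs" "xs ! i < t" "t \<le> xs ! Suc i"
      using sorted_list_interval'[of xs t] xs bwd by auto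
    obtain m :: int and c where mc: "\<And>t. xs ! i \<le> t \<Longrightarrow> t \<le> xs ! Suc i \<Longrightarrow> f (edge_pt G e t) = of_int m * t + c"
      using xs(5)[OF i(1)] by (auto simp: fe_def)
    have "\<forall>\<^sub>F h in at_right 0. h < t - xs ! i"
      using i by (intro eventually_at_right_0_less) auto
    then have "\<forall>\<^sub>F h in at_right 0. f (germ_pt G d h) = f (germ_pt G d 0) + (- of_int m) * h"
      using eventually_at_right_0_pos
      by eventually_elim (use bwd(1-4) i in \<open>simp add: germ_pt_def mc algebra_simps\<close>)
    then show ?thesis by blast
  qed
  then obtain m where m: "\<forall>\<^sub>F h in at_right 0. f (germ_pt G d h) = f (germ_pt G d 0) + m * h" ..
  with sl_eqI[OF m] germ_pt_0[OF G p d] show ?thesis by simp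
qed

definition interior_germ :: "('v, 'e) mgraph \<Rightarrow> 'e tdir \<Rightarrow> real \<Rightarrow> bool" where
  "interior_germ G d h \<longleftrightarrow> (case d of Dir e t b \<Rightarrow> e \<in> edges G \<and>
     0 < (if b then t + h else t - h) \<and> (if b then t + h else t - h) < len G e)"

lemma eventually_interior_germ:
  assumes "metric_graph G" "p \<in> pts G" "d \<in> tdirs G p"
  shows "\<forall>\<^sub>F h in at_right 0. interior_germ G d h"
  using assms
proof (cases rule: tdirs_cases)
  case (fwd e t)
  have "\<forall>\<^sub>F h in at_right 0. h < len G e - t"
    using fwd by (intro eventually_at_right_0_less) auto
  then show ?thesis using eventually_at_right_0_pos
    by eventually_elim (use fwd(1-4) in \<open>simp add: interior_germ_def\<close>)
next
  case (bwd e t)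
  have "\<forall>\<^sub>F h in at_right 0. h < t"
    using bwd by (intro eventually_at_right_0_less) auto
  then show ?thesis using eventually_at_right_0_pos
    by eventually_elim (use bwd(1-4) in \<open>simp add: interior_germ_def\<close>)
qed

lemma interior_germ_pts: "interior_germ G d h \<Longrightarrow> germ_pt G d h \<in> pts G"
  by (cases d) (auto simp: interior_germ_def germ_pt_def edge_pt_def pts_def)

text \<open>A point interior to an edge has exactly two tangent directions, and both are expressed
  in the coordinate of the one germ \<open>d\<close>: outwards as \<open>h + k\<close>, back towards
  its base as \<open>h - k\<close>.\<close>

lemma divf_germ:
  assumes "interior_germ G d h"
    and "\<forall>\<^sub>F k in at_right 0. f (germ_pt G d (h + k)) = f (germ_pt G d h) + m * k"
    and "\<forall>\<^sub>F k in at_right 0. f (germ_pt G d (h - k)) = f (germ_pt G d h) + n * k"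
  shows "divf G f (germ_pt G d h) = - (m + n)"
proof -
  obtain e t b where d: "d = Dir e t b" by (cases d)
  define s where "s = (if b then t + h else t - h)"
  have s: "0 < s" "s < len G e" "e \<in> edges G"
    using assms(1) by (auto simp: d s_def interior_germ_def)
  have "germ_pt G d h = edge_pt G e s"
    by (simp add: d germ_pt_def s_def)
  then have "germ_pt G d h = Inn e s"
    using s by (simp add: edge_pt_def)
  then have td: "tdirs G (germ_pt G d h) = {Dir e s b, Dir e s (\<not> b)}"
    by (cases b) (auto simp: tdirs_def)
  have 1: "germ_pt G (Dir e s b) k = germ_pt G d (h + k)" for k
    by (simp add: d germ_pt_def s_def add.assoc diff_diff_eq)
  have 2: "germ_pt G (Dir e s (\<not> b)) k = germ_pt G d (h - k)" for k
    by (simp add: d germ_pt_def s_def algebra_simps)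
  have "sl G f (Dir e s b) = m" "sl G f (Dir e s (\<not> b)) = n"
    using assms by (auto intro!: sl_eqI simp: 1 2)
  then show ?thesis
    using interior_germ_pts[OF assms(1)] by (simp add: divf_def td)
qed

text \<open>Distinct parameters inside an edge give distinct points, so \<open>q\<close> is met at
  most once and is avoided by all smaller parameters.\<close>

lemma eventually_germ_neq:
  assumes "metric_graph G" "p \<in> pts G" "d \<in> tdirs G p"
  shows "\<forall>\<^sub>F h in at_right 0. germ_pt G d h \<noteq> q"
proof (cases "\<exists>h0>0. germ_pt G d h0 = q \<and> interior_germ G d h0")
  case True
  then obtain h0 where h0: "h0 > 0" "germ_pt G d h0 = q" "interior_germ G d h0" by blast
  show ?thesis
    using eventually_interior_germ[OF assms] eventually_at_right_0_less[OF h0(1)]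
    by eventually_elim
      (use h0 in \<open>cases d; auto simp: germ_pt_def edge_pt_def interior_germ_def split: if_splits\<close>)
next
  case False
  show ?thesis
    using eventually_interior_germ[OF assms] eventually_at_right_0_pos
    by eventually_elim (use False in auto)
qed

lemma eventually_divisor_germ:
  assumes "metric_graph G" "p \<in> pts G" "d \<in> tdirs G p" "divisor G D"
  shows "\<forall>\<^sub>F h in at_right 0. D (germ_pt G d h) = 0"
proof -
  have "\<forall>\<^sub>F h in at_right 0. \<forall>q\<in>{p. D p \<noteq> 0}. germ_pt G d h \<noteq> q"
    using assms by (intro eventually_ball_finite ballI eventually_germ_neq) (auto simp: divisor_def)
  then show ?thesis by (rule eventually_mono) auto
qed

section \<open>Tropical minima along a germ\<close>

definition tmin :: "('v, 'e) mgraph \<Rightarrow> (('v, 'e) point \<Rightarrow> real) set \<Rightarrow>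
    ((('v, 'e) point \<Rightarrow> real) \<Rightarrow> real) \<Rightarrow> ('v, 'e) point \<Rightarrow> real" where
  "tmin G H a p = (if p \<in> pts G then Min ((\<lambda>g. g p + a g) ` H) else 0)"

text \<open>The minimising generators, described by inequalities rather than by \<open>Min\<close>,
  so that these sets can be compared when the point or the coefficients vary.\<close>

definition active :: "(('v, 'e) point \<Rightarrow> real) set \<Rightarrow> ((('v, 'e) point \<Rightarrow> real) \<Rightarrow> real) \<Rightarrow>
    ('v, 'e) point \<Rightarrow> (('v, 'e) point \<Rightarrow> real) set" where
  "active H a p = {g\<in>H. \<forall>h\<in>H. g p + a g \<le> h p + a h}"

lemma active_subset: "active H a p \<subseteq> H"
  by (auto simp: active_def)

lemma active_mem: "g \<in> active H a p \<Longrightarrow> g \<in> H"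
  by (auto simp: active_def)

lemma active_add_const: "active H (\<lambda>g. a g + c) p = active H a p"
  by (auto simp: active_def add.assoc[symmetric])

lemma active_nonempty:
  assumes "finite H" "H \<noteq> {}"
  shows "active H a p \<noteq> {}"
proof -
  obtain g where "g \<in> H" "\<And>h. h \<in> H \<Longrightarrow> g p + a g \<le> h p + a h"
    using assms ex_is_arg_min_if_finite[of H "\<lambda>g. g p + a g"]
    by (auto simp: is_arg_min_linorder)
  then show ?thesis by (auto simp: active_def)
qed

lemma tmin_active:
  assumes "finite H" "g \<in> active H a p" "p \<in> pts G"
  shows "tmin G H a p = g p + a g"
  unfolding tmin_def using assms
  by (auto simp: active_def intro!: Min_eqI)

lemma tmin_le: "finite H \<Longrightarrow> g \<in> H \<Longrightarrow> p \<in> pts G \<Longrightarrow> tmin G H a p \<le> g p + a g"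
  unfolding tmin_def by simp

text \<open>Just after \<open>q\<close> the minimisers are those at \<open>q\<close> with least
  slope. The path \<open>c\<close> and the slopes \<open>s\<close> stay abstract so that the lemma
  serves germs at \<open>p\<close> and also both directions at a point inside a germ, where slopes
  change sign.\<close>

lemma active_along:
  assumes "finite H" and "\<And>g. g \<in> H \<Longrightarrow> \<forall>\<^sub>F k in at_right 0. g (c k) = g q + s g * k"
  shows "\<forall>\<^sub>F k in at_right 0. active H a (c k) =
           {g\<in>active H a q. \<forall>g'\<in>active H a q. s g \<le> (s g' :: real)}"
proof -
  have "\<forall>\<^sub>F k in at_right 0. \<forall>g\<in>H. g (c k) = g q + s g * k"
    using assms by (intro eventually_ball_finite) auto
  moreover have "\<forall>\<^sub>F k in at_right 0. \<forall>g\<in>H. \<forall>g'\<in>H.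
      g q + a g + s g * k \<le> g' q + a g' + s g' * k \<longleftrightarrow>
      g q + a g < g' q + a g' \<or> g q + a g = g' q + a g' \<and> s g \<le> s g'"
    using assms(1) by (intro eventually_ball_finite ballI eventually_lines_le_iff)
  ultimately show ?thesis
  proof eventually_elim
    case (elim k)
    have *: "g (c k) + a g \<le> g' (c k) + a g' \<longleftrightarrow>
        g q + a g < g' q + a g' \<or> g q + a g = g' q + a g' \<and> s g \<le> s g'"
      if "g \<in> H" "g' \<in> H" for g g'
      using elim(2)[rule_format, OF that] elim(1) that by (simp add: algebra_simps)
    have "g \<in> active H a (c k) \<longleftrightarrow> g \<in> active H a q \<and> (\<forall>g'\<in>active H a q. s g \<le> s g')"
      if "g \<in> H" for g
    proof
      assume g: "g \<in> active H a (c k)"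
      then have 1: "g q + a g < g' q + a g' \<or> g q + a g = g' q + a g' \<and> s g \<le> s g'" if "g' \<in> H" for g'
        using * \<open>g \<in> H\<close> that by (auto simp: active_def)
      have "g \<in> active H a q"
        using 1 that by (fastforce simp: active_def)
      moreover have "s g \<le> s g'" if "g' \<in> active H a q" for g'
        using 1[of g'] that \<open>g \<in> H\<close> by (force simp: active_def)
      ultimately show "g \<in> active H a q \<and> (\<forall>g'\<in>active H a q. s g \<le> s g')" by blast
    next
      assume g: "g \<in> active H a q \<and> (\<forall>g'\<in>active H a q. s g \<le> s g')"
      have "g (c k) + a g \<le> g' (c k) + a g'" if "g' \<in> H" for g'
      proof (cases "g q + a g = g' q + a g'")
        case True
        then have "g' \<in> active H a q" using g that by (auto simp: active_def)
        then show ?thesis using * True \<open>g \<in> H\<close> that g by blast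
      next
        case False
        then have "g q + a g < g' q + a g'" using g that by (force simp: active_def)
        then show ?thesis using * \<open>g \<in> H\<close> that by blast
      qed
      then show "g \<in> active H a (c k)" using that by (simp add: active_def)
    qed
    then show ?case using active_subset[of H a "c k"] active_subset[of H a q] by blast
  qed
qed

lemma tmin_along:
  assumes "finite H" and "\<And>g. g \<in> H \<Longrightarrow> \<forall>\<^sub>F k in at_right 0. g (c k) = g q + s g * k"
    and "q \<in> pts G" "\<forall>\<^sub>F k in at_right 0. c k \<in> pts G"
    and g: "g \<in> active H a q" "\<And>g'. g' \<in> active H a q \<Longrightarrow> s g \<le> (s g' :: real)"
  shows "\<forall>\<^sub>F k in at_right 0. tmin G H a (c k) = tmin G H a q + s g * k"
proof -
  have "\<forall>\<^sub>F k in at_right 0. g (c k) = g q + s g * k"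
    using assms(2) active_mem[OF g(1)] .
  moreover have "\<forall>\<^sub>F k in at_right 0. active H a (c k) =
      {g\<in>active H a q. \<forall>g'\<in>active H a q. s g \<le> s g'}"
    by (rule active_along[OF assms(1)]) (rule assms(2))
  moreover note assms(4)
  ultimately
  show ?thesis
  proof eventually_elim
    case (elim k)
    then have "g \<in> active H a (c k)" using g by auto
    with elim tmin_active[OF assms(1) this] tmin_active[OF assms(1) g(1) assms(3)]
    show ?case by simp
  qed
qed

lemma ex_min_slope:
  fixes s :: "_ \<Rightarrow> real"
  assumes "finite H" "H \<noteq> {}"
  obtains g where "g \<in> active H a p" "\<And>g'. g' \<in> active H a p \<Longrightarrow> s g \<le> s g'"
proof -
  have "finite (active H a p)" "active H a p \<noteq> {}"
    using assms active_nonempty finite_subset[OF active_subset] by blast+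
  then show ?thesis
    using ex_is_arg_min_if_finite[of "active H a p" s] that by (auto simp: is_arg_min_linorder)
qed

section \<open>Slopes of tropical minima in a fixed tangent direction\<close>

locale tdir_at =
  fixes G :: "('v, 'e) mgraph" and p :: "('v, 'e) point" and d :: "'e tdir"
  assumes G: "metric_graph G" and p: "p \<in> pts G" and d: "d \<in> tdirs G p"
begin

lemma eventually_germ_pts: "\<forall>\<^sub>F h in at_right 0. germ_pt G d h \<in> pts G"
  using eventually_interior_germ[OF G p d] by eventually_elim (rule interior_germ_pts)

lemma active_germ:
  assumes "finite H" "\<And>g. g \<in> H \<Longrightarrow> pl_fun G g"
  shows "\<forall>\<^sub>F h in at_right 0. active H a (germ_pt G d h) =
           {g\<in>active H a p. \<forall>g'\<in>active H a p. sl G g d \<le> sl G g' d}"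
  by (rule active_along[OF assms(1) pl_fun_germ[OF G assms(2) p d]])

lemma sl_tmin:
  assumes "finite H" "\<And>g. g \<in> H \<Longrightarrow> pl_fun G g"
    and g: "g \<in> active H a p" "\<And>g'. g' \<in> active H a p \<Longrightarrow> sl G g d \<le> sl G g' d"
  shows "sl G (tmin G H a) d = sl G g d"
proof (rule sl_eqI)
  show "\<forall>\<^sub>F h in at_right 0. tmin G H a (germ_pt G d h) = tmin G H a (germ_pt G d 0) + sl G g d * h"
    unfolding germ_pt_0[OF G p d]
    by (rule tmin_along[where s = "\<lambda>g. sl G g d",
        OF assms(1) pl_fun_germ[OF G assms(2) p d] p eventually_germ_pts g])
qed

lemma sl_tmin_le:
  assumes "finite H" "\<And>g. g \<in> H \<Longrightarrow> pl_fun G g" "g \<in> active H a p"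
  shows "sl G (tmin G H a) d \<le> sl G g d"
proof -
  obtain g' where g': "g' \<in> active H a p" "\<And>h. h \<in> active H a p \<Longrightarrow> sl G g' d \<le> sl G h d"
    using ex_min_slope[OF assms(1), of a p "\<lambda>g. sl G g d"] active_mem[OF assms(3)] by blast
  show ?thesis using sl_tmin[OF assms(1,2) g'] g'(2)[OF assms(3)] by simp
qed

end

text \<open>Dependence is applied at a nearby point of the germ instead of at \<open>p\<close>: the
  minimisers there are the minimisers at \<open>p\<close> of least slope along \<open>d\<close>, and
  there are two of them. A single choice of coefficients serves all points and directions.\<close>

lemma trop_dep_active:
  assumes "trop_dep G F" "finite F" "\<And>f. f \<in> F \<Longrightarrow> pl_fun G f" "metric_graph G"
  shows "\<exists>a. \<forall>p\<in>pts G. \<forall>d\<in>tdirs G p.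
      \<exists>f\<in>active F a p. \<exists>g\<in>active F a p. f \<noteq> g \<and> sl G f d = sl G g d \<and>
        (\<forall>h\<in>active F a p. sl G f d \<le> sl G h d)"
proof -
  obtain a where a: "\<And>p. p \<in> pts G \<Longrightarrow> \<exists>f\<in>F. \<exists>g\<in>F. f \<noteq> g \<and>
        f p + a f = Min ((\<lambda>h. h p + a h) ` F) \<and> g p + a g = Min ((\<lambda>h. h p + a h) ` F)"
    using assms(1) unfolding trop_dep_def by blast
  have a2: "\<exists>f\<in>active F a q. \<exists>g\<in>active F a q. f \<noteq> g" if "q \<in> pts G" for q
  proof -
    obtain f g where fg: "f \<in> F" "g \<in> F" "f \<noteq> g"
      "f q + a f = Min ((\<lambda>h. h q + a h) ` F)" "g q + a g = Min ((\<lambda>h. h q + a h) ` F)"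
      using a[OF \<open>q \<in> pts G\<close>] by blast
    have "Min ((\<lambda>h. h q + a h) ` F) \<le> h q + a h" if "h \<in> F" for h
      using that assms(2) by simp
    then have "f \<in> active F a q" "g \<in> active F a q"
      using fg(1,2) unfolding active_def fg(4)[symmetric] fg(5)[symmetric]
      by (simp_all add: fg(4,5))
    then show ?thesis using fg(3) by blast
  qed
  show ?thesis
  proof (intro exI ballI)
    fix p d assume pd: "p \<in> pts G" "d \<in> tdirs G p"
    interpret tdir_at G p d using pd assms(4) by unfold_locales
    have "\<exists>h. active F a (germ_pt G d h) =
           {g\<in>active F a p. \<forall>g'\<in>active F a p. sl G g d \<le> sl G g' d} \<and> germ_pt G d h \<in> pts G"
      using eventually_happens'[OF trivial_limit_at_right_real
          eventually_conj[OF active_germ[OF assms(2), of a] eventually_germ_pts]] assms(3) by blast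
    then obtain h where h: "active F a (germ_pt G d h) =
           {g\<in>active F a p. \<forall>g'\<in>active F a p. sl G g d \<le> sl G g' d}" "germ_pt G d h \<in> pts G" by blast
    obtain f g where "f \<noteq> g" "f \<in> active F a (germ_pt G d h)" "g \<in> active F a (germ_pt G d h)"
      using a2[OF h(2)] by blast
    then show "\<exists>f\<in>active F a p. \<exists>g\<in>active F a p. f \<noteq> g \<and> sl G f d = sl G g d \<and>
        (\<forall>h\<in>active F a p. sl G f d \<le> sl G h d)"
      unfolding h(1) by (intro bexI[of _ f] bexI[of _ g]) (auto intro: antisym)
  qed
qed

text \<open>The sets \<open>A h\<close> descend like a staircase, neighbours sharing at most one
  value. Each has two elements \<open>s < t\<close>, and \<open>t\<close> bounds all earlier sets
  from below, so \<open>s\<close> is new; the first set contributes two.\<close>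

lemma card_less_card_chain:
  fixes A :: "real \<Rightarrow> real set"
  assumes "finite X" "X \<noteq> {}" "\<And>h. h \<in> X \<Longrightarrow> finite (A h)"
    "\<And>h. h \<in> X \<Longrightarrow> \<exists>s\<in>A h. \<exists>t\<in>A h. s < t"
    "\<And>h h' s t. h \<in> X \<Longrightarrow> h' \<in> X \<Longrightarrow> h < h' \<Longrightarrow> s \<in> A h \<Longrightarrow> t \<in> A h' \<Longrightarrow> t \<le> s"
  shows "card X < card (\<Union>h\<in>X. A h)"
  using assms
proof (induction X rule: finite_linorder_max_induct)
  case (insert b X)
  obtain s t where st: "s \<in> A b" "t \<in> A b" "s < t" using insert.prems(3)[of b] by blast
  have fin: "finite (\<Union>h\<in>insert b X. A h)" using insert by auto
  show ?case
  proof (cases "X = {}")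
    case True
    have "card {s, t} \<le> card (\<Union>h\<in>insert b X. A h)"
      using st fin by (intro card_mono) auto
    then show ?thesis using True st by simp
  next
    case False
    have "card X < card (\<Union>h\<in>X. A h)"
    proof (rule insert.IH)
      show "t \<le> s" if "h \<in> X" "h' \<in> X" "h < h'" "s \<in> A h" "t \<in> A h'" for h h' s t
        using insert.prems(4)[of h h' s t] that by blast
    qed (use insert.prems(2,3) False in auto)
    moreover have "s \<notin> (\<Union>h\<in>X. A h)"
    proof
      assume "s \<in> (\<Union>h\<in>X. A h)"
      then obtain h where "h \<in> X" "s \<in> A h" by blast
      then have "t \<le> s" using insert.prems(4)[of h b s t] insert.hyps(2) st by auto
      with st show False by simp
    qed
    moreover have "card (insert s (\<Union>h\<in>X. A h)) \<le> card (\<Union>h\<in>insert b X. A h)"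
      using st fin by (intro card_mono) auto
    ultimately show ?thesis using insert fin by auto
  qed
qed auto

text \<open>Every generator is affine on the whole germ and \<open>D\<close> vanishes there, so each
  point of \<open>X\<close> is a concave kink of the minimum. The length \<epsilon> is chosen before
  \<open>a\<close> and \<open>X\<close>; this uniformity is what allows the coefficients to vary
  along a sequence later.\<close>

lemma (in tdir_at) card_active_slopes_germ:
  assumes H: "finite H" "H \<noteq> {}" "\<And>g. g \<in> H \<Longrightarrow> pl_fun G g" and D: "divisor G D"
  shows "\<exists>\<epsilon>>0. (\<forall>h. 0 < h \<and> h < \<epsilon> \<longrightarrow> germ_pt G d h \<in> pts G \<and>
      (\<forall>g\<in>H. g (germ_pt G d h) = g p + sl G g d * h)) \<and>
    (\<forall>a X. finite X \<and> X \<noteq> {} \<and> X \<subseteq> {0<..<\<epsilon>} \<and>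
      (\<forall>h\<in>X. of_int (D (germ_pt G d h)) + divf G (tmin G H a) (germ_pt G d h) \<ge> 1) \<longrightarrow>
      card X < card ((\<lambda>g. sl G g d) ` (\<Union>h\<in>X. active H a (germ_pt G d h))))"
proof -
  have "\<forall>\<^sub>F h in at_right 0. interior_germ G d h \<and> D (germ_pt G d h) = 0 \<and>
      (\<forall>g\<in>H. g (germ_pt G d h) = g p + sl G g d * h)"
    using H by (intro eventually_conj eventually_ball_finite ballI
      eventually_interior_germ[OF G p d] eventually_divisor_germ[OF G p d D] pl_fun_germ[OF G _ p d])
  then obtain \<epsilon> where "\<epsilon> > 0" and germ: "\<And>h. 0 < h \<Longrightarrow> h < \<epsilon> \<Longrightarrow> interior_germ G d h"
    "\<And>h. 0 < h \<Longrightarrow> h < \<epsilon> \<Longrightarrow> D (germ_pt G d h) = 0"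
    "\<And>h g. 0 < h \<Longrightarrow> h < \<epsilon> \<Longrightarrow> g \<in> H \<Longrightarrow> g (germ_pt G d h) = g p + sl G g d * h"
    unfolding eventually_at_right_field by metis
  show ?thesis
  proof (intro exI[of _ \<epsilon>] conjI allI impI ballI)
    show "germ_pt G d h \<in> pts G" if "0 < h \<and> h < \<epsilon>" for h
      using that by (intro interior_germ_pts germ) auto
    show "g (germ_pt G d h) = g p + sl G g d * h" if "0 < h \<and> h < \<epsilon>" "g \<in> H" for h g
      using that by (intro germ) auto
    fix a X assume "finite X \<and> X \<noteq> {} \<and> X \<subseteq> {0<..<\<epsilon>} \<and>
      (\<forall>h\<in>X. of_int (D (germ_pt G d h)) + divf G (tmin G H a) (germ_pt G d h) \<ge> 1)"
    then have X: "finite X" "X \<noteq> {}" "\<And>h. h \<in> X \<Longrightarrow> 0 < h" "\<And>h. h \<in> X \<Longrightarrow> h < \<epsilon>"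
      "\<And>h. h \<in> X \<Longrightarrow> of_int (D (germ_pt G d h)) + divf G (tmin G H a) (germ_pt G d h) \<ge> 1"
      by auto
    define A where "A h = (\<lambda>g. sl G g d) ` active H a (germ_pt G d h)" for h
    have "card X < card (\<Union>h\<in>X. A h)"
    proof (rule card_less_card_chain[OF X(1,2)])
      show "finite (A h)" for h
        unfolding A_def using H finite_subset[OF active_subset] by blast
    next
      fix h assume h: "h \<in> X"
      let ?q = "germ_pt G d h"
      have q: "?q \<in> pts G" by (intro interior_germ_pts germ X h)
      have r: "\<forall>\<^sub>F k in at_right 0. k < min h (\<epsilon> - h)"
        using X(3,4)[OF h] by (intro eventually_at_right_0_less) auto
      have lin1: "\<forall>\<^sub>F k in at_right 0. g (germ_pt G d (h + k)) = g ?q + sl G g d * k"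
        and lin2: "\<forall>\<^sub>F k in at_right 0. g (germ_pt G d (h - k)) = g ?q + (- sl G g d) * k"
        if "g \<in> H" for g
        using r eventually_at_right_0_pos
        by (eventually_elim; use that X(3,4)[OF h] in \<open>simp add: germ(3) algebra_simps\<close>)+
      have p1: "\<forall>\<^sub>F k in at_right 0. germ_pt G d (h + k) \<in> pts G"
        and p2: "\<forall>\<^sub>F k in at_right 0. germ_pt G d (h - k) \<in> pts G"
        using r eventually_at_right_0_pos
        by (eventually_elim; use X(3,4)[OF h] in \<open>auto intro!: interior_germ_pts germ\<close>)+
      obtain g1 where g1: "g1 \<in> active H a ?q" "\<And>g'. g' \<in> active H a ?q \<Longrightarrow> sl G g1 d \<le> sl G g' d"
        using ex_min_slope[OF H(1,2), of a ?q "\<lambda>g. sl G g d"] by blast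
      obtain g2 where g2: "g2 \<in> active H a ?q" "\<And>g'. g' \<in> active H a ?q \<Longrightarrow> - sl G g2 d \<le> - sl G g' d"
        using ex_min_slope[OF H(1,2), of a ?q "\<lambda>g. - sl G g d"] by blast
      \<comment> \<open>Outwards the minimum follows the least active slope; backwards it follows
        the greatest one, with sign reversed.\<close>
      have "divf G (tmin G H a) ?q = - (sl G g1 d + - sl G g2 d)"
        using tmin_along[where s = "\<lambda>g. sl G g d", OF H(1) lin1 q p1 g1]
          tmin_along[where s = "\<lambda>g. - sl G g d", OF H(1) lin2 q p2 g2]
        by (intro divf_germ germ X h) auto
      then have "sl G g1 d < sl G g2 d"
        using X(5)[OF h] germ(2)[OF X(3)[OF h] X(4)[OF h]] by simp
      then show "\<exists>s\<in>A h. \<exists>t\<in>A h. s < t"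
        using g1(1) g2(1) unfolding A_def by blast
    next
      fix h h' s t assume h: "h \<in> X" "h' \<in> X" "h < h'" and "s \<in> A h" "t \<in> A h'"
      then obtain g g' where g: "g \<in> active H a (germ_pt G d h)" "s = sl G g d"
        and g': "g' \<in> active H a (germ_pt G d h')" "t = sl G g' d"
        unfolding A_def by blast
      have gH: "g \<in> H" "g' \<in> H" using g g' active_mem by blast+
      have "g (germ_pt G d h) + a g \<le> g' (germ_pt G d h) + a g'"
        "g' (germ_pt G d h') + a g' \<le> g (germ_pt G d h') + a g"
        using g(1) g'(1) gH by (auto simp: active_def)
      \<comment> \<open>Adding the two minimality inequalities cancels the coefficients and the
        values at \<open>p\<close>.\<close>
      then have "t * h' - t * h \<le> s * h' - s * h"
        using gH X(3,4)[OF h(1)] X(3,4)[OF h(2)] by (simp add: germ(3) g(2) g'(2))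
      then have "(t - s) * (h' - h) \<le> 0" by (simp add: algebra_simps)
      then show "t \<le> s" using h(3) by (simp add: mult_le_0_iff)
    qed
    also have "(\<Union>h\<in>X. A h) = (\<lambda>g. sl G g d) ` (\<Union>h\<in>X. active H a (germ_pt G d h))"
      unfolding A_def by blast
    finally show "card X < card ((\<lambda>g. sl G g d) ` (\<Union>h\<in>X. active H a (germ_pt G d h)))" .
  qed fact
qed

section \<open>Finitely generated modules of piecewise linear functions\<close>

lemma tspan_eq: "tspan G S = {tmin G H a | H a. H \<subseteq> S \<and> H \<noteq> {}}"
  by (simp add: tspan_def tmin_def[abs_def])

lemma tmin_eqI:
  assumes "finite H" "\<And>h. h \<in> H \<Longrightarrow> v \<le> h p + a h" "\<exists>h\<in>H. h p + a h \<le> v" "p \<in> pts G"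
  shows "tmin G H a p = v"
proof -
  obtain h where "h \<in> H" "h p + a h \<le> v" using assms(3) by blast
  then have "h p + a h = v" using assms(2)[of h] by linarith
  then show ?thesis
    using assms(1,2,4) \<open>h \<in> H\<close> by (auto simp: tmin_def intro!: Min_eqI)
qed

lemma tmin_tspan:
  assumes S: "finite S" and F: "finite F" "F \<noteq> {}" "F \<subseteq> tspan G S"
  shows "tmin G F b \<in> tspan G S"
proof -
  have "\<forall>f\<in>F. \<exists>H a. f = tmin G H a \<and> H \<subseteq> S \<and> H \<noteq> {}"
    using F(3) by (auto simp: tspan_eq)
  then obtain K c where K: "\<And>f. f \<in> F \<Longrightarrow> f = tmin G (K f) (c f)" "\<And>f. f \<in> F \<Longrightarrow> K f \<subseteq> S"
    "\<And>f. f \<in> F \<Longrightarrow> K f \<noteq> {}" by metis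
  have finK: "finite (K f)" if "f \<in> F" for f using K(2)[OF that] S finite_subset by blast
  define H where "H = (\<Union>f\<in>F. K f)"
  \<comment> \<open>A generator can occur in several members of \<open>F\<close>; in the flattened
    minimum only its cheapest total coefficient matters.\<close>
  define w where "w g = Min ((\<lambda>f. c f g + b f) ` {f\<in>F. g \<in> K f})" for g
  have "finite H" "H \<subseteq> S" "H \<noteq> {}"
    using F K finK by (auto simp: H_def)
  have "tmin G F b = tmin G H w"
  proof
    fix p show "tmin G F b p = tmin G H w p"
    proof (cases "p \<in> pts G")
      case True
      obtain f where f: "f \<in> active F b p" using active_nonempty[OF F(1,2)] by blast
      then have fF: "f \<in> F" by (rule active_mem)
      obtain g where g: "g \<in> active (K f) (c f) p"
        using active_nonempty[OF finK[OF fF] K(3)[OF fF]] by blast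
      have fp: "f p = g p + c f g"
        using tmin_active[OF finK[OF fF] g True] K(1)[OF fF] by simp
      have gK: "g \<in> K f" using g by (rule active_mem)
      have "tmin G H w p = f p + b f"
      proof (rule tmin_eqI[OF \<open>finite H\<close> _ _ True])
        fix k assume "k \<in> H"
        then have "w k \<in> (\<lambda>f. c f k + b f) ` {f\<in>F. k \<in> K f}"
          unfolding w_def H_def using F(1) by (intro Min_in) auto
        then obtain f' where f': "f' \<in> F" "k \<in> K f'" "w k = c f' k + b f'" by blast
        have "f p + b f \<le> f' p + b f'" using f f'(1) by (simp add: active_def)
        also have "f' p \<le> k p + c f' k"
          using tmin_le[OF finK[OF f'(1)] f'(2) True, of "c f'"] K(1)[OF f'(1)] by simp
        finally show "f p + b f \<le> k p + w k" using f'(3) by simp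
      next
        have "w g \<le> c f g + b f"
          unfolding w_def using F(1) fF gK by (intro Min_le) auto
        then have "g p + w g \<le> f p + b f" using fp by simp
        then show "\<exists>h\<in>H. h p + w h \<le> f p + b f"
          using gK fF unfolding H_def by blast
      qed
      then show ?thesis using tmin_active[OF F(1) f True] by simp
    qed (simp add: tmin_def)
  qed
  then show ?thesis using \<open>H \<subseteq> S\<close> \<open>H \<noteq> {}\<close> by (auto simp: tspan_eq)
qed

lemma fg_module_tmin:
  assumes "fg_module G \<Sigma>" "finite F" "F \<noteq> {}" "F \<subseteq> \<Sigma>"
  shows "tmin G F b \<in> \<Sigma>"
  using assms tmin_tspan unfolding fg_module_def by blast

text \<open>The generators in \<open>fg_module\<close> need not belong to the module, since
  \<open>tspan\<close> sets values off the graph to 0. They are replaced by their normalised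
  versions \<open>R g\<close>, which do belong to it.\<close>

lemma fg_moduleE:
  assumes "fg_module G \<Sigma>"
  obtains S where "finite S" "S \<subseteq> \<Sigma>" "\<Sigma> = tspan G S"
proof -
  obtain S where S: "finite S" "\<Sigma> = tspan G S" using assms by (auto simp: fg_module_def)
  define R where "R g = tmin G {g} (\<lambda>_. 0)" for g
  have R: "R g p = g p" if "p \<in> pts G" for g p using that by (simp add: R_def tmin_def)
  have "R ` S \<subseteq> \<Sigma>"
    unfolding S(2) tspan_eq R_def by blast
  moreover have "\<Sigma> \<subseteq> tspan G (R ` S)"
  proof
    fix f assume "f \<in> \<Sigma>"
    then obtain H a where H: "f = tmin G H a" "H \<subseteq> S" "H \<noteq> {}" by (auto simp: S(2) tspan_eq)
    have fin: "finite H" using H S finite_subset by blast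
    \<comment> \<open>Different generators may have the same normalisation, so the least coefficient
      over the fibre is taken.\<close>
    define b where "b h = Min (a ` {g\<in>H. R g = h})" for h
    have "f = tmin G (R ` H) b"
    proof
      fix p show "f p = tmin G (R ` H) b p"
      proof (cases "p \<in> pts G")
        case True
        obtain g where g: "g \<in> active H a p" using active_nonempty[OF fin H(3)] by blast
        then have gH: "g \<in> H" by (rule active_mem)
        have "tmin G (R ` H) b p = g p + a g"
        proof (rule tmin_eqI[OF _ _ _ True])
          fix h assume "h \<in> R ` H"
          then have "b h \<in> a ` {g\<in>H. R g = h}"
            unfolding b_def using fin by (intro Min_in) auto
          then obtain k where k: "k \<in> H" "R k = h" "b h = a k" by blast
          have "h p = k p" using R[OF True, of k] k(2) by simp
          then show "g p + a g \<le> h p + b h" using g k by (simp add: active_def)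
        next
          have "b (R g) \<le> a g" unfolding b_def using fin gH by (intro Min_le) auto
          then have "R g p + b (R g) \<le> g p + a g" using R[OF True] by simp
          then show "\<exists>h\<in>R ` H. h p + b h \<le> g p + a g" using gH by blast
        qed (use fin in simp)
        then show ?thesis unfolding H(1) using tmin_active[OF fin g True] by simp
      qed (simp add: H(1) tmin_def)
    qed
    moreover have "R ` H \<subseteq> R ` S" "R ` H \<noteq> {}" using H(2,3) by auto
    ultimately show "f \<in> tspan G (R ` S)" unfolding tspan_eq by blast
  qed
  moreover have "tspan G (R ` S) \<subseteq> \<Sigma>"
  proof
    fix f assume "f \<in> tspan G (R ` S)"
    then obtain H a where H: "f = tmin G H a" "H \<subseteq> R ` S" "H \<noteq> {}" by (auto simp: tspan_eq)
    have "finite H" using H(2) S(1) finite_surj by blast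
    moreover have "H \<subseteq> \<Sigma>" using H(2) \<open>R ` S \<subseteq> \<Sigma>\<close> by blast
    ultimately show "f \<in> \<Sigma>" unfolding H(1) using assms H(3) by (intro fg_module_tmin)
  qed
  ultimately show ?thesis using S(1) by (intro that[of "R ` S"]) auto
qed

text \<open>Adding real constants gives infinitely many functions. This later supplies the padding
  needed to apply condition (3), which asks for an exact number of functions.\<close>

lemma infinite_fg_module:
  assumes "fg_module G \<Sigma>" "\<Sigma> \<noteq> {}" "p \<in> pts G"
  shows "infinite \<Sigma>"
proof -
  obtain f where f: "f \<in> \<Sigma>" using assms by blast
  let ?s = "\<lambda>c. tmin G {f} (\<lambda>_. c)"
  have s: "?s c p = f p + c" for c using assms(3) by (simp add: tmin_def)
  have "inj ?s"
  proof (rule injI)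
    fix b c assume "?s b = ?s c"
    then have "?s b p = ?s c p" by (rule arg_cong)
    then show "b = c" unfolding s by simp
  qed
  then have "infinite (range ?s)" using finite_imageD infinite_UNIV_char_0 by blast
  moreover have "range ?s \<subseteq> \<Sigma>" using fg_module_tmin[OF assms(1)] f by blast
  ultimately show ?thesis using finite_subset by blast
qed

lemma pl_fun_bounded:
  assumes G: "metric_graph G" and f: "pl_fun G f"
  shows "bounded (f ` pts G)"
proof -
  have e: "bounded (fe G f e ` {0..<len G e})" if "e \<in> edges G" for e
  proof -
    obtain xs where xs: "sorted_wrt (<) xs" "2 \<le> length xs" "hd xs = 0" "last xs = len G e"
      "\<And>i. Suc i < length xs \<Longrightarrow>
        \<exists>m :: int. \<exists>c :: real. \<forall>t\<in>{xs ! i .. xs ! Suc i}. fe G f e t = of_int m * t + c"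
      using pl_funE[OF f \<open>e \<in> edges G\<close>] by metis
    have "bounded (fe G f e ` {xs ! i .. xs ! Suc i})" if i: "Suc i < length xs" for i
    proof -
      obtain m :: int and c where "\<forall>t\<in>{xs ! i .. xs ! Suc i}. fe G f e t = of_int m * t + c"
        using xs(5)[OF i] by blast
      then have "continuous_on {xs ! i .. xs ! Suc i} (fe G f e)"
        by (subst continuous_on_cong[OF refl, where g = "\<lambda>t. of_int m * t + c"])
          (auto intro!: continuous_intros)
      then show ?thesis
        by (intro compact_imp_bounded compact_continuous_image) auto
    qed
    moreover have "finite {i. Suc i < length xs}"
      by (rule finite_subset[of _ "{..<length xs}"]) auto
    ultimately have "bounded (\<Union>i\<in>{i. Suc i < length xs}. fe G f e ` {xs ! i .. xs ! Suc i})"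
      by (intro bounded_UN ballI) simp_all
    moreover have "fe G f e ` {0..<len G e} \<subseteq> (\<Union>i\<in>{i. Suc i < length xs}. fe G f e ` {xs ! i .. xs ! Suc i})"
    proof
      fix y assume "y \<in> fe G f e ` {0..<len G e}"
      then obtain t where t: "0 \<le> t" "t < len G e" "y = fe G f e t" by auto
      obtain i where "Suc i < length xs" "xs ! i \<le> t" "t < xs ! Suc i"
        using sorted_list_interval[of xs t] xs t by auto
      then show "y \<in> (\<Union>i\<in>{i. Suc i < length xs}. fe G f e ` {xs ! i .. xs ! Suc i})"
        using t(3) by auto
    qed
    ultimately show ?thesis by (rule bounded_subset)
  qed
  have "bounded (f ` Vtx ` verts G \<union> (\<Union>e\<in>edges G. fe G f e ` {0..<len G e}))"
    unfolding bounded_Un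
  proof
    show "bounded (f ` Vtx ` verts G)"
      using G by (intro finite_imp_bounded) (simp add: metric_graph_def)
    show "bounded (\<Union>e\<in>edges G. fe G f e ` {0..<len G e})"
      using G e by (intro bounded_UN) (simp_all add: metric_graph_def)
  qed
  moreover have "f ` pts G \<subseteq> f ` Vtx ` verts G \<union> (\<Union>e\<in>edges G. fe G f e ` {0..<len G e})"
  proof
    fix y assume "y \<in> f ` pts G"
    then consider "y \<in> f ` Vtx ` verts G" | e t where "e \<in> edges G" "0 < t" "t < len G e" "y = f (Inn e t)"
      unfolding pts_def by blast
    then show "y \<in> f ` Vtx ` verts G \<union> (\<Union>e\<in>edges G. fe G f e ` {0..<len G e})"
    proof cases
      case 2
      then have "y \<in> fe G f e ` {0..<len G e}"
        by (intro image_eqI[of _ _ t]) (simp_all add: fe_def edge_pt_def)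
      with 2(1) show ?thesis by blast
    qed simp
  qed
  ultimately show ?thesis by (rule bounded_subset)
qed

text \<open>A generator whose coefficient exceeds the smallest one by more than the oscillation of the
  generators never attains the minimum, so its coefficient can be lowered to a fixed bound.\<close>

lemma tspan_bounded_coeffs:
  assumes G: "metric_graph G" and S: "finite S" "\<And>g. g \<in> S \<Longrightarrow> pl_fun G g"
  shows "\<exists>B. \<forall>f\<in>tspan G S. \<exists>a c. (\<forall>g\<in>S. 0 \<le> a g \<and> a g \<le> (B :: real)) \<and> f = tmin G S (\<lambda>g. a g + c)"
proof -
  have "bounded (\<Union>g\<in>S. g ` pts G)"
    using S pl_fun_bounded[OF G] by (intro bounded_UN) auto
  then obtain C where C: "\<And>g p. g \<in> S \<Longrightarrow> p \<in> pts G \<Longrightarrow> \<bar>g p\<bar> \<le> C"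
    unfolding bounded_iff by fastforce
  show ?thesis
  proof (intro exI[of _ "2 * \<bar>C\<bar>"] ballI)
    fix f assume "f \<in> tspan G S"
    then obtain H b where H: "f = tmin G H b" "H \<subseteq> S" "H \<noteq> {}" by (auto simp: tspan_eq)
    have fin: "finite H" using H S finite_subset by blast
    obtain g0 where g0: "g0 \<in> H" "\<And>h. h \<in> H \<Longrightarrow> b g0 \<le> b h"
      using ex_is_arg_min_if_finite[of H b] fin H(3) by (auto simp: is_arg_min_linorder)
    \<comment> \<open>Two generators differ by at most \<open>2 * \<bar>C\<bar>\<close> at two
      bounds \<open>C\<close> on their absolute values, so a coefficient this far above that of
      \<open>g0\<close> never lowers the minimum. Generators outside \<open>H\<close> receive the
      same cap, which makes the minimum run over all of \<open>S\<close>.\<close>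
    define a where "a g = (if g \<in> H \<and> b g - b g0 \<le> 2 * \<bar>C\<bar> then b g - b g0 else 2 * \<bar>C\<bar>)" for g
    have "f = tmin G S (\<lambda>g. a g + b g0)"
    proof
      fix p show "f p = tmin G S (\<lambda>g. a g + b g0) p"
      proof (cases "p \<in> pts G")
        case True
        obtain g1 where g1: "g1 \<in> active H b p" using active_nonempty[OF fin H(3)] by blast
        then have g1H: "g1 \<in> H" by (rule active_mem)
        have le: "g1 p + b g1 \<le> h p + b h" if "h \<in> H" for h using g1 that by (simp add: active_def)
        have "tmin G S (\<lambda>g. a g + b g0) p = g1 p + b g1"
        proof (rule tmin_eqI[OF S(1) _ _ True])
          fix h assume h: "h \<in> S"
          show "g1 p + b g1 \<le> h p + (a h + b g0)"
          proof (cases "h \<in> H \<and> b h - b g0 \<le> 2 * \<bar>C\<bar>")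
            case True
            then show ?thesis using le[of h] by (simp add: a_def)
          next
            case False
            have "g0 p \<le> h p + 2 * \<bar>C\<bar>" using C[of g0 p] C[of h p] h True g0(1) H(2) by fastforce
            then show ?thesis using le[OF g0(1)] False by (auto simp: a_def)
          qed
        next
          \<comment> \<open>A generator that attains the minimum somewhere is never capped.\<close>
          have "g0 p \<le> g1 p + 2 * \<bar>C\<bar>" using C[of g0 p] C[of g1 p] g1H True g0(1) H(2) by fastforce
          then have "b g1 - b g0 \<le> 2 * \<bar>C\<bar>" using le[OF g0(1)] by linarith
          then show "\<exists>h\<in>S. h p + (a h + b g0) \<le> g1 p + b g1"
            using g1H H(2) by (intro bexI[of _ g1]) (auto simp: a_def)
        qed
        then show ?thesis unfolding H(1) using tmin_active[OF fin g1 True] by simp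
      qed (simp add: H(1) tmin_def)
    qed
    moreover have "\<forall>g\<in>S. 0 \<le> a g \<and> a g \<le> 2 * \<bar>C\<bar>" using g0(2) by (simp add: a_def)
    ultimately show "\<exists>a c. (\<forall>g\<in>S. 0 \<le> a g \<and> a g \<le> 2 * \<bar>C\<bar>) \<and> f = tmin G S (\<lambda>g. a g + c)"
      by blast
  qed
qed

text \<open>Divisors are given by indexed families of points with repetition counted, so the degree
  is \<open>card I\<close> with no injectivity to check. The same form covers spread points and a
  multiple of one point.\<close>

lemma effective_count:
  assumes "finite I" "\<And>i. i \<in> I \<Longrightarrow> q i \<in> pts G"
  shows "effective G (\<lambda>p. int (card {i\<in>I. q i = p}))"
    "deg (\<lambda>p. int (card {i\<in>I. q i = p})) = int (card I)"
proof -
  have supp: "{p. int (card {i\<in>I. q i = p}) \<noteq> 0} = q ` I" using assms(1) by auto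
  show "effective G (\<lambda>p. int (card {i\<in>I. q i = p}))"
    using assms unfolding effective_def divisor_def supp by auto
  have "int (card I) = (\<Sum>p\<in>q ` I. int (card {i\<in>I. q i = p}))"
    using sum.image_gen[OF assms(1), of "\<lambda>_. 1 :: int" q] by simp
  then show "deg (\<lambda>p. int (card {i\<in>I. q i = p})) = int (card I)"
    unfolding deg_def supp by simp
qed

lemma tls_exists:
  assumes "tls G D (int (card I)) \<Sigma>" "finite I" "\<And>i. i \<in> I \<Longrightarrow> q i \<in> pts G"
  shows "\<exists>f\<in>\<Sigma>. \<forall>p\<in>pts G. of_int (D p) + divf G f p \<ge> card {i\<in>I. q i = p}"
proof -
  have "\<exists>f\<in>\<Sigma>. \<forall>p\<in>pts G. of_int (D p) + divf G f p \<ge> of_int (int (card {i\<in>I. q i = p}))"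
    using assms(1)[unfolded tls_def, THEN conjunct2, THEN conjunct2, THEN conjunct1, rule_format,
        OF conjI, OF effective_count[OF assms(2,3)]] by simp
  then show ?thesis by simp
qed

lemma tls_exists_ge_1:
  assumes "tls G D (int (card I)) \<Sigma>" "finite I" "\<And>i. i \<in> I \<Longrightarrow> q i \<in> pts G"
  shows "\<exists>f\<in>\<Sigma>. \<forall>i\<in>I. of_int (D (q i)) + divf G f (q i) \<ge> 1"
proof -
  obtain f where f: "f \<in> \<Sigma>" "\<And>p. p \<in> pts G \<Longrightarrow> of_int (D p) + divf G f p \<ge> card {i\<in>I. q i = p}"
    using tls_exists[OF assms(1,2), of q] assms(3) by blast
  have "of_int (D (q i)) + divf G f (q i) \<ge> 1" if "i \<in> I" for i
  proof -
    have "{j\<in>I. q j = q i} \<noteq> {}" using that by blast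
    then have "card {j\<in>I. q j = q i} \<ge> 1" using assms(2) by (simp add: Suc_le_eq card_gt_0_iff)
    then have "1 \<le> real (card {j\<in>I. q j = q i})" by simp
    with f(2)[OF assms(3)[OF that]] show ?thesis by linarith
  qed
  with f(1) show ?thesis by blast
qed

section \<open>Tropical linear series and slopes at a point\<close>

text \<open>With \<open>t e = sl G f e\<close>, the slopes counted here determine the local rank of \<open>f\<close> at \<open>p\<close>.\<close>

definition slopes_above :: "('v, 'e) mgraph \<Rightarrow> (('v, 'e) point \<Rightarrow> real) set \<Rightarrow> ('v, 'e) point \<Rightarrow>
    ('e tdir \<Rightarrow> real) \<Rightarrow> 'e tdir \<Rightarrow> real set" where
  "slopes_above G \<Sigma> p t d = (\<lambda>f. sl G f d) ` {f\<in>\<Sigma>. \<forall>e\<in>tdirs G p. t e \<le> sl G f e}"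

lemma slopes_above_mono: "\<Sigma>' \<subseteq> \<Sigma> \<Longrightarrow> slopes_above G \<Sigma>' p t d \<subseteq> slopes_above G \<Sigma> p t d"
  by (auto simp: slopes_above_def)

lemma slopes_above_subset: "slopes_above G \<Sigma> p t d \<subseteq> (\<lambda>f. sl G f d) ` \<Sigma>"
  by (auto simp: slopes_above_def)

section \<open>Consequences of conditions (1) and (2)\<close>

lemma tls_fg: "tls G D k \<Sigma> \<Longrightarrow> fg_module G \<Sigma>"
  by (simp add: tls_def)

lemma tls_RD: "tls G D k \<Sigma> \<Longrightarrow> \<Sigma> \<subseteq> RD G D"
  by (simp add: tls_def)

lemma tls_pl: "tls G D k \<Sigma> \<Longrightarrow> f \<in> \<Sigma> \<Longrightarrow> pl_fun G f"
  using tls_RD by (fastforce simp: RD_def)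

lemma tls_trop_dep:
  "tls G D k \<Sigma> \<Longrightarrow> F \<subseteq> \<Sigma> \<Longrightarrow> finite F \<Longrightarrow> int (card F) = k + 2 \<Longrightarrow> trop_dep G F"
  unfolding tls_def by blast

lemma tls_nonempty: "tls G D (int k) \<Sigma> \<Longrightarrow> p \<in> pts G \<Longrightarrow> \<Sigma> \<noteq> {}"
  using tls_exists[of G D "{..<k}" \<Sigma> "\<lambda>_. p"] by auto

text \<open>A single function is never tropically dependent. This makes the base case of the
  inductions on rank vacuous.\<close>

lemma tls_minus_one:
  assumes "tls G D (-1) \<Sigma>" "p \<in> pts G"
  shows "\<Sigma> = {}"
proof (rule ccontr)
  assume "\<Sigma> \<noteq> {}"
  then obtain f where "f \<in> \<Sigma>" by blast
  then have "trop_dep G {f}" using assms(1) by (intro tls_trop_dep) auto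
  then show False using assms(2) unfolding trop_dep_def by blast
qed

context tdir_at
begin

text \<open>Among \<open>k + 2\<close> functions with distinct slopes along \<open>d\<close>,
  dependence would produce two different minimisers with equal slope along \<open>d\<close>.\<close>

lemma tls_finite_slopes:
  assumes "tls G D (int k) \<Sigma>"
  shows "finite ((\<lambda>f. sl G f d) ` \<Sigma>)" "card ((\<lambda>f. sl G f d) ` \<Sigma>) \<le> k + 1"
proof -
  let ?A = "(\<lambda>f. sl G f d) ` \<Sigma>"
  have "\<not> (\<exists>T\<subseteq>?A. finite T \<and> card T = k + 2)"
  proof
    assume "\<exists>T\<subseteq>?A. finite T \<and> card T = k + 2"
    then obtain T where T: "T \<subseteq> ?A" "finite T" "card T = k + 2" by blast
    then obtain F where F: "F \<subseteq> \<Sigma>" "inj_on (\<lambda>f. sl G f d) F" "T = (\<lambda>f. sl G f d) ` F"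
      using subset_image_inj[of T "\<lambda>f. sl G f d" \<Sigma>] by blast
    have "finite F" "card F = k + 2"
      using F T finite_image_iff[OF F(2)] card_image[OF F(2)] by auto
    then have dep: "trop_dep G F" using F(1) assms by (intro tls_trop_dep) auto
    have pl: "pl_fun G f" if "f \<in> F" for f using F(1) that tls_pl[OF assms] by blast
    obtain a where "\<exists>f\<in>active F a p. \<exists>g\<in>active F a p. f \<noteq> g \<and> sl G f d = sl G g d"
      using trop_dep_active[OF dep \<open>finite F\<close> pl G] p d by blast
    then show False using F(2) active_subset unfolding inj_on_def by blast
  qed
  then show "finite ?A" "card ?A \<le> k + 1"
    using infinite_arbitrarily_large[of ?A "k + 2"] obtain_subset_with_card_n[of "k + 2" ?A]
    by (blast, metis Suc_1 Suc_eq_plus1 add_Suc_right not_less_eq_eq)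
qed

end

text \<open>Condition (1) is applied to the divisors obtained from \<open>\<Sum> n(v) v\<close> by spreading the mass at
  each \<open>v\<close> over \<open>n(v)\<close> distinct points converging to \<open>v\<close> along the direction \<open>\<eta>(v)\<close>.\<close>

lemma tls_exists_spread:
  assumes G: "metric_graph G" and D: "divisor G D" and \<Sigma>: "tls G D (int k) \<Sigma>"
    and V: "finite V" "V \<subseteq> pts G" "V \<noteq> {}" and n: "(\<Sum>v\<in>V. n v) = k"
    and \<eta>: "\<And>v. v \<in> V \<Longrightarrow> \<eta> v \<in> tdirs G v"
  shows "\<exists>f\<in>\<Sigma>. \<forall>v\<in>V. n v < card (slopes_above G \<Sigma> v (sl G f) (\<eta> v))"
proof -
  have td: "tdir_at G v (\<eta> v)" if "v \<in> V" for v
    using that G V \<eta> by unfold_locales auto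
  obtain S where S: "finite S" "S \<subseteq> \<Sigma>" "\<Sigma> = tspan G S" using fg_moduleE[OF tls_fg[OF \<Sigma>]] .
  have Spl: "pl_fun G g" if "g \<in> S" for g using S(2) that tls_pl[OF \<Sigma>] by blast
  have "\<Sigma> \<noteq> {}" using tls_nonempty[OF \<Sigma>] V by blast
  then have "S \<noteq> {}" using S(3) by (auto simp: tspan_eq)
  obtain B where B: "\<And>f. f \<in> \<Sigma> \<Longrightarrow>
      \<exists>a c. (\<forall>g\<in>S. 0 \<le> a g \<and> a g \<le> (B :: real)) \<and> f = tmin G S (\<lambda>g. a g + c)"
    using tspan_bounded_coeffs[OF G S(1) Spl] S(3) by blast
  obtain \<epsilon> where \<epsilon>: "\<And>v. v \<in> V \<Longrightarrow> \<epsilon> v > (0 :: real)"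
    "\<And>v h. v \<in> V \<Longrightarrow> 0 < h \<Longrightarrow> h < \<epsilon> v \<Longrightarrow> germ_pt G (\<eta> v) h \<in> pts G"
    "\<And>v h g. v \<in> V \<Longrightarrow> 0 < h \<Longrightarrow> h < \<epsilon> v \<Longrightarrow> g \<in> S \<Longrightarrow>
      g (germ_pt G (\<eta> v) h) = g v + sl G g (\<eta> v) * h"
    "\<And>v a X. v \<in> V \<Longrightarrow> finite X \<Longrightarrow> X \<noteq> {} \<Longrightarrow> X \<subseteq> {0<..<\<epsilon> v} \<Longrightarrow>
      \<forall>h\<in>X. of_int (D (germ_pt G (\<eta> v) h)) + divf G (tmin G S a) (germ_pt G (\<eta> v) h) \<ge> 1 \<Longrightarrow>
      card X < card ((\<lambda>g. sl G g (\<eta> v)) ` (\<Union>h\<in>X. active S a (germ_pt G (\<eta> v) h)))"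
  proof -
    define P where "P v e \<longleftrightarrow> e > (0 :: real) \<and>
        (\<forall>h. 0 < h \<and> h < e \<longrightarrow> germ_pt G (\<eta> v) h \<in> pts G \<and>
          (\<forall>g\<in>S. g (germ_pt G (\<eta> v) h) = g v + sl G g (\<eta> v) * h)) \<and>
        (\<forall>a X. finite X \<and> X \<noteq> {} \<and> X \<subseteq> {0<..<e} \<and>
          (\<forall>h\<in>X. of_int (D (germ_pt G (\<eta> v) h)) + divf G (tmin G S a) (germ_pt G (\<eta> v) h) \<ge> 1) \<longrightarrow>
          card X < card ((\<lambda>g. sl G g (\<eta> v)) ` (\<Union>h\<in>X. active S a (germ_pt G (\<eta> v) h))))" for v e
    have "\<exists>e. P v e" if "v \<in> V" for v
      using tdir_at.card_active_slopes_germ[OF td[OF that] S(1) \<open>S \<noteq> {}\<close> Spl D] unfolding P_def .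
    then obtain \<epsilon> where "\<And>v. v \<in> V \<Longrightarrow> P v (\<epsilon> v)" by metis
    then show thesis by (intro that[of \<epsilon>]) (simp_all add: P_def)
  qed
  \<comment> \<open>A common scale for all points of \<open>V\<close>, below every \<epsilon> and
    tending to 0.\<close>
  define \<delta> where "\<delta> N = Min (\<epsilon> ` V) / real (Suc N)" for N
  have \<delta>: "\<delta> N > 0" "v \<in> V \<Longrightarrow> \<delta> N \<le> \<epsilon> v" for N v
  proof -
    have *: "Min (\<epsilon> ` V) > 0" using V \<epsilon>(1) by auto
    then show "\<delta> N > 0" by (simp add: \<delta>_def)
    assume "v \<in> V"
    have "\<delta> N \<le> Min (\<epsilon> ` V)" using * by (simp add: \<delta>_def divide_le_eq mult_le_cancel_left1)
    also have "\<dots> \<le> \<epsilon> v" using \<open>v \<in> V\<close> V by auto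
    finally show "\<delta> N \<le> \<epsilon> v" .
  qed
  have \<delta>_lim: "\<delta> \<longlonglongrightarrow> 0"
    unfolding \<delta>_def by (rule LIMSEQ_Suc[OF lim_const_over_n])
  \<comment> \<open>Distinct positive parameters; for \<open>j < k\<close> the factor
    \<open>(j + 1) / (k + 2)\<close> is below 1, so at least \<open>n v\<close> of them fit below
    \<open>\<delta> N\<close> for every \<open>v\<close>.\<close>
  define h where "h N j = \<delta> N * (real j + 1) / (real k + 2)" for N and j :: nat
  have h: "0 < h N j" "j < k \<Longrightarrow> h N j < \<delta> N" "inj (h N)" for N j
  proof -
    show "0 < h N j" using \<delta>(1)[of N] by (simp add: h_def)
    show "h N j < \<delta> N" if "j < k"
      using \<delta>(1)[of N] that by (simp add: h_def divide_less_eq mult_less_cancel_left_pos)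
    show "inj (h N)" using \<delta>(1)[of N] by (auto simp: h_def inj_def)
  qed
  define I where "I = (SIGMA v:V. {..<n v})"
  have "finite I" "card I = k" using V(1) n by (auto simp: I_def)
  have nk: "n v \<le> k" if "v \<in> V" for v
    using member_le_sum[of v V n] V(1) that n by auto
  have "\<exists>f\<in>\<Sigma>. \<forall>v\<in>V. \<forall>j<n v. of_int (D (germ_pt G (\<eta> v) (h N j))) + divf G f (germ_pt G (\<eta> v) (h N j)) \<ge> 1" for N
  proof -
    have "germ_pt G (\<eta> (fst i)) (h N (snd i)) \<in> pts G" if i: "i \<in> I" for i
    proof -
      have v: "fst i \<in> V" "snd i < n (fst i)" using i by (auto simp: I_def)
      have "h N (snd i) < \<delta> N" using v nk[OF v(1)] by (intro h) auto
      also have "\<dots> \<le> \<epsilon> (fst i)" using v by (intro \<delta>)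
      finally show ?thesis using v h(1) by (intro \<epsilon>)
    qed
    from tls_exists_ge_1[of G D I \<Sigma> "\<lambda>i. germ_pt G (\<eta> (fst i)) (h N (snd i))", OF _ \<open>finite I\<close> this]
    obtain f where "f \<in> \<Sigma>" "\<And>i. i \<in> I \<Longrightarrow> of_int (D (germ_pt G (\<eta> (fst i)) (h N (snd i)))) +
        divf G f (germ_pt G (\<eta> (fst i)) (h N (snd i))) \<ge> 1"
      using \<Sigma> \<open>card I = k\<close> by auto
    then show ?thesis by (intro bexI[of _ f]) (force simp: I_def)+
  qed
  then have "\<exists>a c. (\<forall>g\<in>S. 0 \<le> a g \<and> a g \<le> B) \<and> (\<forall>v\<in>V. \<forall>j<n v.
      of_int (D (germ_pt G (\<eta> v) (h N j))) + divf G (tmin G S (\<lambda>g. a g + c)) (germ_pt G (\<eta> v) (h N j)) \<ge> 1)" for N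
    using B by metis
  then obtain a c where a: "\<And>N g. g \<in> S \<Longrightarrow> 0 \<le> a N g" "\<And>N g. g \<in> S \<Longrightarrow> a N g \<le> B"
    and ac: "\<And>N v j. v \<in> V \<Longrightarrow> j < n v \<Longrightarrow> of_int (D (germ_pt G (\<eta> v) (h N j))) +
      divf G (tmin G S (\<lambda>g. a N g + c N)) (germ_pt G (\<eta> v) (h N j)) \<ge> 1"
    by metis
  \<comment> \<open>Compactness of \<open>[0, B]\<close>, one generator at a time. Only the bounded
    parts \<open>a N\<close> converge; the constants \<open>c N\<close> may diverge, but they do not
    affect which generators are minimal.\<close>
  have "\<exists>b s. strict_mono s \<and> (\<forall>g\<in>S. (\<lambda>N. a (s N) g) \<longlonglongrightarrow> b g)"
    using S(1) a
  proof (induction S rule: finite_induct)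
    case empty
    show ?case by (auto intro: strict_mono_id)
  next
    case (insert g T)
    then obtain b s where bs: "strict_mono s" "\<And>g. g \<in> T \<Longrightarrow> (\<lambda>N. a (s N) g) \<longlonglongrightarrow> b g"
      by (metis insertCI)
    have "\<forall>N. a (s N) g \<in> {0..B}" using insert.prems by auto
    then obtain l r where lr: "strict_mono r" "((\<lambda>N. a (s N) g) \<circ> r) \<longlonglongrightarrow> l"
      using compact_Icc[of 0 B, unfolded compact_def] by meson
    have "(\<lambda>N. a ((s \<circ> r) N) g') \<longlonglongrightarrow> (b(g := l)) g'" if "g' \<in> insert g T" for g'
      using that insert.hyps(2) lr LIMSEQ_subseq_LIMSEQ[OF bs(2) lr(1)] by (auto simp: o_def)
    then show ?case using strict_mono_o[OF bs(1) lr(1)] by blast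
  qed
  then obtain b s where bs: "strict_mono s" "\<And>g. g \<in> S \<Longrightarrow> (\<lambda>N. a (s N) g) \<longlonglongrightarrow> b g" by blast
  define f where "f = tmin G S b"
  have "f \<in> \<Sigma>" unfolding f_def by (rule fg_module_tmin[OF tls_fg[OF \<Sigma>] S(1) \<open>S \<noteq> {}\<close> S(2)])
  have "(\<delta> \<circ> s) \<longlonglongrightarrow> 0" by (rule LIMSEQ_subseq_LIMSEQ[OF \<delta>_lim bs(1)])
  then have \<delta>s: "(\<lambda>N. \<delta> (s N)) \<longlonglongrightarrow> 0" by (simp add: o_def)
  have "n v < card (slopes_above G \<Sigma> v (sl G f) (\<eta> v))" if v: "v \<in> V" for v
  proof -
    interpret tdir_at G v "\<eta> v" by (rule td[OF v])
    have above: "(\<lambda>g. sl G g (\<eta> v)) ` active S b v \<subseteq> slopes_above G \<Sigma> v (sl G f) (\<eta> v)"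
    proof
      fix y assume "y \<in> (\<lambda>g. sl G g (\<eta> v)) ` active S b v"
      then obtain g where g: "g \<in> active S b v" "y = sl G g (\<eta> v)" by blast
      have "sl G f e \<le> sl G g e" if "e \<in> tdirs G v" for e
      proof -
        interpret e: tdir_at G v e using that G p by unfold_locales
        show ?thesis unfolding f_def using S(1) Spl g(1) by (rule e.sl_tmin_le)
      qed
      then show "y \<in> slopes_above G \<Sigma> v (sl G f) (\<eta> v)"
        using g active_mem[OF g(1)] S(2) unfolding slopes_above_def by blast
    qed
    have fin: "finite (slopes_above G \<Sigma> v (sl G f) (\<eta> v))"
      by (rule finite_subset[OF slopes_above_subset tls_finite_slopes(1)[OF \<Sigma>]])
    show ?thesis
    proof (cases "n v = 0")
      \<comment> \<open>With no points placed at \<open>v\<close>, one minimiser at \<open>v\<close>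
        already gives the required count of at least 1.\<close>
      case True
      have "slopes_above G \<Sigma> v (sl G f) (\<eta> v) \<noteq> {}"
        using above active_nonempty[OF S(1) \<open>S \<noteq> {}\<close>, of b v] by blast
      then show ?thesis using fin True by (simp add: card_gt_0_iff)
    next
      case False
      \<comment> \<open>A strict gap at \<open>v\<close> for the limit coefficients persists on the
        whole germ of length \<open>\<delta> (s N)\<close> for late \<open>N\<close>: the
        coefficients converge and the slopes shift the gap by at most
        \<open>\<bar>?m\<bar> * \<delta> (s N)\<close>.\<close>
      have "\<forall>\<^sub>F N in sequentially. \<forall>g\<in>S. \<forall>g'\<in>S. g' v + b g' < g v + b g \<longrightarrow>
          (\<forall>t. 0 < t \<and> t < \<delta> (s N) \<longrightarrow> g' (germ_pt G (\<eta> v) t) + a (s N) g' < g (germ_pt G (\<eta> v) t) + a (s N) g)"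
      proof (intro eventually_ball_finite ballI S(1))
        fix g g' assume gg: "g \<in> S" "g' \<in> S"
        let ?m = "sl G g (\<eta> v) - sl G g' (\<eta> v)"
        show "\<forall>\<^sub>F N in sequentially. g' v + b g' < g v + b g \<longrightarrow>
          (\<forall>t. 0 < t \<and> t < \<delta> (s N) \<longrightarrow> g' (germ_pt G (\<eta> v) t) + a (s N) g' < g (germ_pt G (\<eta> v) t) + a (s N) g)"
        proof (cases "g' v + b g' < g v + b g")
          case True
          have "(\<lambda>N. g v - g' v + (a (s N) g - a (s N) g') - \<bar>?m\<bar> * \<delta> (s N)) \<longlonglongrightarrow>
              g v - g' v + (b g - b g') - \<bar>?m\<bar> * 0"
            by (intro tendsto_intros bs(2) gg \<delta>s)
          then have "\<forall>\<^sub>F N in sequentially. g v - g' v + (a (s N) g - a (s N) g') - \<bar>?m\<bar> * \<delta> (s N) > 0"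
            by (rule order_tendstoD) (use True in simp)
          then show ?thesis
          proof (rule eventually_mono, intro impI allI)
            fix N t assume N: "g v - g' v + (a (s N) g - a (s N) g') - \<bar>?m\<bar> * \<delta> (s N) > 0"
              and t: "0 < t \<and> t < \<delta> (s N)"
            have "- ?m * t \<le> \<bar>?m\<bar> * \<delta> (s N)"
              using t by (intro mult_mono) auto
            moreover have "t < \<epsilon> v" using t \<delta>(2)[OF v, of "s N"] by linarith
            then have "g (germ_pt G (\<eta> v) t) - g' (germ_pt G (\<eta> v) t) = g v - g' v + ?m * t"
              using \<epsilon>(3)[OF v] t gg by (simp add: algebra_simps)
            ultimately show "g' (germ_pt G (\<eta> v) t) + a (s N) g' < g (germ_pt G (\<eta> v) t) + a (s N) g"
              using N by linarith
          qed
        qed simp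
      qed
      then obtain N where N: "\<And>g g' t. g \<in> S \<Longrightarrow> g' \<in> S \<Longrightarrow> g' v + b g' < g v + b g \<Longrightarrow>
          0 < t \<Longrightarrow> t < \<delta> (s N) \<Longrightarrow> g' (germ_pt G (\<eta> v) t) + a (s N) g' < g (germ_pt G (\<eta> v) t) + a (s N) g"
        unfolding eventually_sequentially by blast
      define X where "X = h (s N) ` {..<n v}"
      have X: "finite X" "X \<noteq> {}" "card X = n v"
        using False card_image[OF inj_on_subset[OF h(3)], of "{..<n v}"] by (auto simp: X_def)
      have X\<delta>: "0 < t" "t < \<delta> (s N)" if "t \<in> X" for t
        using that h(1,2) nk[OF v] by (auto simp: X_def)
      have "n v < card ((\<lambda>g. sl G g (\<eta> v)) ` (\<Union>t\<in>X. active S (\<lambda>g. a (s N) g + c (s N)) (germ_pt G (\<eta> v) t)))"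
        unfolding X(3)[symmetric]
      proof (rule \<epsilon>(4)[OF v X(1,2)])
        show "X \<subseteq> {0<..<\<epsilon> v}" using X\<delta> \<delta>(2)[OF v, of "s N"] by fastforce
        show "\<forall>t\<in>X. 1 \<le> of_int (D (germ_pt G (\<eta> v) t)) +
            divf G (tmin G S (\<lambda>g. a (s N) g + c (s N))) (germ_pt G (\<eta> v) t)"
          using ac[OF v] by (auto simp: X_def)
      qed
      also have "\<dots> \<le> card (slopes_above G \<Sigma> v (sl G f) (\<eta> v))"
      proof (intro card_mono fin order_trans[OF _ above] image_mono UN_least)
        fix t assume t: "t \<in> X"
        show "active S (\<lambda>g. a (s N) g + c (s N)) (germ_pt G (\<eta> v) t) \<subseteq> active S b v"
          unfolding active_add_const
        proof
          fix g assume g: "g \<in> active S (a (s N)) (germ_pt G (\<eta> v) t)"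
          have "g v + b g \<le> g' v + b g'" if "g' \<in> S" for g'
          proof (rule ccontr)
            assume "\<not> g v + b g \<le> g' v + b g'"
            then have "g' (germ_pt G (\<eta> v) t) + a (s N) g' < g (germ_pt G (\<eta> v) t) + a (s N) g"
              using N X\<delta>[OF t] that active_mem[OF g] by force
            moreover have "g (germ_pt G (\<eta> v) t) + a (s N) g \<le> g' (germ_pt G (\<eta> v) t) + a (s N) g'"
              using g that by (simp add: active_def)
            ultimately show False by linarith
          qed
          then show "g \<in> active S b v" using active_mem[OF g] by (simp add: active_def)
        qed
      qed
      finally show ?thesis .
    qed
  qed
  with \<open>f \<in> \<Sigma>\<close> show ?thesis by blast
qed

text \<open>The upper bound comes from dependence, the lower one from spreading the entire degree
  \<open>k\<close> along \<open>d\<close>.\<close>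

lemma (in tdir_at) tls_card_slopes:
  assumes "tls G D (int k) \<Sigma>" "divisor G D"
  shows "card ((\<lambda>f. sl G f d) ` \<Sigma>) = k + 1"
proof -
  obtain f where "k < card (slopes_above G \<Sigma> p (sl G f) d)"
    using tls_exists_spread[OF G assms(2,1), of "{p}" "\<lambda>_. k" "\<lambda>_. d"] p d by auto
  also have "\<dots> \<le> card ((\<lambda>f. sl G f d) ` \<Sigma>)"
    by (intro card_mono slopes_above_subset tls_finite_slopes(1)[OF assms(1)])
  finally show ?thesis using tls_finite_slopes(2)[OF assms(1)] by simp
qed

section \<open>Descent to subseries and counts of dominating slopes\<close>

lemma srl_tls: "srl G D (Suc k) (Suc k) \<Sigma> \<Longrightarrow> tls G D (int k) \<Sigma>"
  by simp

text \<open>Condition (3) speaks of exactly \<open>k\<close> functions; a smaller set is padded with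
  arbitrary members of the infinite \<Sigma>.\<close>

lemma srl_subseries:
  assumes "srl G D (Suc k) (Suc k) \<Sigma>" "p \<in> pts G" and U: "U \<subseteq> \<Sigma>" "finite U" "card U \<le> k"
  shows "\<exists>\<Sigma>'. \<Sigma>' \<subseteq> \<Sigma> \<and> U \<subseteq> \<Sigma>' \<and> srl G D k k \<Sigma>'"
proof -
  have tls: "tls G D (int k) \<Sigma>" by (rule srl_tls[OF assms(1)])
  have "infinite (\<Sigma> - U)"
    using infinite_fg_module[OF tls_fg[OF tls] tls_nonempty[OF tls assms(2)] assms(2)] U(2) by simp
  then obtain T where T: "T \<subseteq> \<Sigma> - U" "finite T" "card T = k - card U"
    using infinite_arbitrarily_large by blast
  have "card (U \<union> T) = k" using T U by (subst card_Un_disjoint) auto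
  moreover have "U \<union> T \<subseteq> \<Sigma>" "finite (U \<union> T)" using T U by auto
  ultimately have UT: "U \<union> T \<subseteq> \<Sigma> \<and> finite (U \<union> T) \<and> card (U \<union> T) = k" by (intro conjI)
  have "\<forall>S. S \<subseteq> \<Sigma> \<and> finite S \<and> card S = k \<longrightarrow> (\<exists>\<Sigma>'. \<Sigma>' \<subseteq> \<Sigma> \<and> S \<subseteq> \<Sigma>' \<and> srl G D k k \<Sigma>')"
    using assms(1) by simp
  from spec[OF this, of "U \<union> T"] UT
  have "\<exists>\<Sigma>'. \<Sigma>' \<subseteq> \<Sigma> \<and> U \<union> T \<subseteq> \<Sigma>' \<and> srl G D k k \<Sigma>'" by (rule mp)
  then obtain \<Sigma>' where "\<Sigma>' \<subseteq> \<Sigma>" "U \<union> T \<subseteq> \<Sigma>'" "srl G D k k \<Sigma>'" by blast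
  then show ?thesis by blast
qed

text \<open>One representative per value, with \<open>f\<close> chosen for its own value. In the
  descent this retains all counted slopes and \<open>f\<close> itself at a cost of only
  \<open>card T\<close> functions.\<close>

lemma ex_preimage_containing:
  assumes "T \<subseteq> \<phi> ` A" "finite T" "f \<in> A" "\<phi> f \<in> T"
  shows "\<exists>U\<subseteq>A. finite U \<and> f \<in> U \<and> inj_on \<phi> U \<and> \<phi> ` U = T \<and> card U = card T"
proof -
  define \<psi> where "\<psi> y = (if y = \<phi> f then f else SOME x. x \<in> A \<and> \<phi> x = y)" for y
  have \<psi>: "\<psi> y \<in> A \<and> \<phi> (\<psi> y) = y" if "y \<in> T" for y
  proof (cases "y = \<phi> f")
    case False
    have "\<exists>x. x \<in> A \<and> \<phi> x = y" using assms(1) that by blast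
    from someI_ex[OF this] False show ?thesis by (simp add: \<psi>_def)
  qed (use assms in \<open>simp add: \<psi>_def\<close>)
  have inj: "inj_on \<psi> T" using \<psi> by (metis inj_onI)
  have "\<psi> (\<phi> f) = f" by (simp add: \<psi>_def)
  then have "f \<in> \<psi> ` T" using assms(4) by force
  moreover have "inj_on \<phi> (\<psi> ` T)" using \<psi> by (auto intro!: inj_onI)
  moreover have "\<phi> ` \<psi> ` T = T" using \<psi> by force
  ultimately show ?thesis
    using \<psi> assms(2) card_image[OF inj] by (intro exI[of _ "\<psi> ` T"]) auto
qed

text \<open>Take \<open>k + 1\<close> dominating functions \<open>U\<close> with distinct slopes
  along \<open>d\<close> and add \<open>h\<close>: the result is dependent. Looking along
  \<open>d\<close> shows that \<open>h\<close> is a minimiser at \<open>p\<close>; looking along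
  \<open>e\<close> bounds its slope from below by that of a member of \<open>U\<close>.\<close>

lemma slope_ge_if_slopes_above_full:
  assumes G: "metric_graph G" and \<Sigma>: "tls G D (int k) \<Sigma>" and p: "p \<in> pts G" and d: "d \<in> tdirs G p"
    and card: "card (slopes_above G \<Sigma> p t d) = k + 1" and h: "h \<in> \<Sigma>" and e: "e \<in> tdirs G p"
  shows "t e \<le> sl G h e"
proof -
  interpret tdir_at G p d using G p d by unfold_locales
  let ?A = "{f\<in>\<Sigma>. \<forall>e\<in>tdirs G p. t e \<le> sl G f e}"
  obtain U where U: "U \<subseteq> ?A" "inj_on (\<lambda>f. sl G f d) U" "slopes_above G \<Sigma> p t d = (\<lambda>f. sl G f d) ` U"
    using subset_image_inj[of "slopes_above G \<Sigma> p t d" "\<lambda>f. sl G f d" ?A]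
    unfolding slopes_above_def by blast
  have cU: "card U = k + 1" using U card card_image by metis
  then have finU: "finite U" using card.infinite by fastforce
  show ?thesis
  proof (cases "h \<in> U")
    case True
    then show ?thesis using U(1) e by blast
  next
    case False
    have sub: "insert h U \<subseteq> \<Sigma>" using U(1) h by blast
    have dep: "trop_dep G (insert h U)"
      using finU cU False by (intro tls_trop_dep[OF \<Sigma> sub]) auto
    have pl: "pl_fun G f" if "f \<in> insert h U" for f using sub that tls_pl[OF \<Sigma>] by blast
    obtain a where a: "\<And>p d. p \<in> pts G \<Longrightarrow> d \<in> tdirs G p \<Longrightarrow>
      \<exists>f\<in>active (insert h U) a p. \<exists>g\<in>active (insert h U) a p. f \<noteq> g \<and> sl G f d = sl G g d \<and>
        (\<forall>h'\<in>active (insert h U) a p. sl G f d \<le> sl G h' d)"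
    proof -
      have "finite (insert h U)" using finU by simp
      with dep have "\<exists>a. \<forall>p\<in>pts G. \<forall>d\<in>tdirs G p.
          \<exists>f\<in>active (insert h U) a p. \<exists>g\<in>active (insert h U) a p. f \<noteq> g \<and> sl G f d = sl G g d \<and>
            (\<forall>h'\<in>active (insert h U) a p. sl G f d \<le> sl G h' d)"
        using pl G by (intro trop_dep_active)
      then show thesis by (elim exE) (rule that, blast)
    qed
    \<comment> \<open>Otherwise both minimisers with equal slope along \<open>d\<close> would lie in
      \<open>U\<close>, where these slopes are distinct.\<close>
    have act: "h \<in> active (insert h U) a p"
    proof (rule ccontr)
      assume "h \<notin> active (insert h U) a p"
      then have "active (insert h U) a p \<subseteq> U" using active_subset by blast
      moreover obtain f g where "f \<in> active (insert h U) a p" "g \<in> active (insert h U) a p"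
        "f \<noteq> g" "sl G f d = sl G g d" using a[OF p d] by blast
      ultimately show False using U(2) by (auto dest: inj_onD)
    qed
    obtain f g where fg: "f \<in> active (insert h U) a p" "g \<in> active (insert h U) a p" "f \<noteq> g"
      "sl G f e = sl G g e" "\<And>h'. h' \<in> active (insert h U) a p \<Longrightarrow> sl G f e \<le> sl G h' e"
      using a[OF p e] by blast
    \<comment> \<open>Two different least-slope minimisers cannot both be \<open>h\<close>.\<close>
    have "f \<in> U \<or> g \<in> U" using fg(1-3) active_subset by blast
    then have "t e \<le> sl G f e" using U(1) e fg(4) by fastforce
    also have "\<dots> \<le> sl G h e" by (rule fg(5)[OF act])
    finally show ?thesis .
  qed
qed

text \<open>While the count along \<open>d\<close> is at most \<open>k\<close>, representatives of
  the counted slopes fit into a subseries of smaller rank: the count along \<open>d\<close> is kept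
  and the one along \<open>d'\<close> can only drop, hence an inequality. At \<open>k + 1\<close>
  every function dominates, so \<open>d'\<close> also sees all its \<open>k + 1\<close> slopes. The
  bound \<open>t\<close> is arbitrary, as total rankability concerns every vector of the
  cube.\<close>

lemma card_slopes_above_le:
  assumes G: "metric_graph G" and D: "divisor G D" and p: "p \<in> pts G"
    and d: "d \<in> tdirs G p" and d': "d' \<in> tdirs G p"
  shows "srl G D k k \<Sigma> \<Longrightarrow> card (slopes_above G \<Sigma> p t d) \<le> card (slopes_above G \<Sigma> p t d')"
proof (induction k arbitrary: \<Sigma>)
  case 0
  then have "\<Sigma> = {}" using tls_minus_one[OF _ p] by simp
  then show ?case by (simp add: slopes_above_def)
next
  case (Suc k)
  interpret tdir_at G p d using G p d by unfold_locales
  interpret d': tdir_at G p d' using G p d' by unfold_locales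
  have tls: "tls G D (int k) \<Sigma>" by (rule srl_tls[OF Suc.prems])
  have fin: "finite (slopes_above G \<Sigma> p t d)"
    by (rule finite_subset[OF slopes_above_subset tls_finite_slopes(1)[OF tls]])
  have fin': "finite (slopes_above G \<Sigma> p t d')"
    by (rule finite_subset[OF slopes_above_subset d'.tls_finite_slopes(1)[OF tls]])
  have le: "card (slopes_above G \<Sigma> p t d) \<le> k + 1"
    using card_mono[OF tls_finite_slopes(1)[OF tls] slopes_above_subset[of G \<Sigma> p t d]]
      tls_finite_slopes(2)[OF tls] by simp
  consider "slopes_above G \<Sigma> p t d = {}" | "slopes_above G \<Sigma> p t d \<noteq> {}" "card (slopes_above G \<Sigma> p t d) \<le> k"
    | "card (slopes_above G \<Sigma> p t d) = k + 1"
    using le by linarith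
  then show ?case
  proof cases
    case 2
    let ?A = "{f\<in>\<Sigma>. \<forall>e\<in>tdirs G p. t e \<le> sl G f e}"
    obtain f where f: "f \<in> ?A" using 2(1) by (auto simp: slopes_above_def)
    obtain U where U: "U \<subseteq> ?A" "finite U" "(\<lambda>f. sl G f d) ` U = slopes_above G \<Sigma> p t d"
      "card U = card (slopes_above G \<Sigma> p t d)"
      using ex_preimage_containing[of "slopes_above G \<Sigma> p t d" "\<lambda>f. sl G f d" ?A f] fin f
      unfolding slopes_above_def by blast
    have "U \<subseteq> \<Sigma>" using U(1) by blast
    then obtain \<Sigma>' where \<Sigma>': "\<Sigma>' \<subseteq> \<Sigma>" "U \<subseteq> \<Sigma>'" "srl G D k k \<Sigma>'"
      using srl_subseries[OF Suc.prems p _ U(2)] U(4) 2(2) by metis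
    have "slopes_above G \<Sigma> p t d = slopes_above G \<Sigma>' p t d"
      using U(1,3) \<Sigma>'(2) slopes_above_mono[OF \<Sigma>'(1)] unfolding slopes_above_def by blast
    also have "card (slopes_above G \<Sigma>' p t d) \<le> card (slopes_above G \<Sigma>' p t d')"
      by (rule Suc.IH[OF \<Sigma>'(3)])
    also have "\<dots> \<le> card (slopes_above G \<Sigma> p t d')"
      by (rule card_mono[OF fin' slopes_above_mono[OF \<Sigma>'(1)]])
    finally show ?thesis .
  next
    case 3
    have "slopes_above G \<Sigma> p t d' = (\<lambda>f. sl G f d') ` \<Sigma>"
      using slope_ge_if_slopes_above_full[OF G tls p d 3] unfolding slopes_above_def by blast
    then show ?thesis using 3 d'.tls_card_slopes[OF tls D] by simp
  qed simp
qed

lemma card_slopes_above_eq: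
  assumes "metric_graph G" "divisor G D" "p \<in> pts G" "d \<in> tdirs G p" "d' \<in> tdirs G p" "srl G D k k \<Sigma>"
  shows "card (slopes_above G \<Sigma> p t d) = card (slopes_above G \<Sigma> p t d')"
  using card_slopes_above_le[OF assms(1-3)] assms(4-6) by (intro antisym)

text \<open>The descent keeps \<open>f\<close> and one function for each counted slope, so the left
  side is unchanged while the rank drops. The right side depends only on \<open>f\<close>,
  \<open>D\<close> and \<open>p\<close>, not on the series.\<close>

lemma divf_ge_card_slopes_above:
  assumes G: "metric_graph G" and D: "divisor G D" and p: "p \<in> pts G" and d: "d \<in> tdirs G p"
  shows "srl G D k k \<Sigma> \<Longrightarrow> f \<in> \<Sigma> \<Longrightarrow>
    real (card (slopes_above G \<Sigma> p (sl G f) d)) \<le> of_int (D p) + divf G f p + 1"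
proof (induction k arbitrary: \<Sigma>)
  case 0
  then have "\<Sigma> = {}" using tls_minus_one[OF _ p] by simp
  with 0 show ?case by simp
next
  case (Suc k)
  interpret tdir_at G p d using G p d by unfold_locales
  let ?t = "sl G f"
  have tls: "tls G D (int k) \<Sigma>" by (rule srl_tls[OF Suc.prems(1)])
  have fin: "finite (slopes_above G \<Sigma> p ?t d)"
    by (rule finite_subset[OF slopes_above_subset tls_finite_slopes(1)[OF tls]])
  have le: "card (slopes_above G \<Sigma> p ?t d) \<le> k + 1"
    using card_mono[OF tls_finite_slopes(1)[OF tls] slopes_above_subset[of G \<Sigma> p ?t d]]
      tls_finite_slopes(2)[OF tls] by simp
  consider "card (slopes_above G \<Sigma> p ?t d) \<le> k" | "card (slopes_above G \<Sigma> p ?t d) = k + 1"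
    using le by linarith
  then show ?case
  proof cases
    case 1
    let ?A = "{g\<in>\<Sigma>. \<forall>e\<in>tdirs G p. ?t e \<le> sl G g e}"
    have f: "f \<in> ?A" using Suc.prems(2) by simp
    obtain U where U: "U \<subseteq> ?A" "finite U" "f \<in> U" "(\<lambda>f. sl G f d) ` U = slopes_above G \<Sigma> p ?t d"
      "card U = card (slopes_above G \<Sigma> p ?t d)"
      using ex_preimage_containing[of "slopes_above G \<Sigma> p ?t d" "\<lambda>f. sl G f d" ?A f] fin f
      unfolding slopes_above_def by blast
    have "U \<subseteq> \<Sigma>" using U(1) by blast
    then obtain \<Sigma>' where \<Sigma>': "\<Sigma>' \<subseteq> \<Sigma>" "U \<subseteq> \<Sigma>'" "srl G D k k \<Sigma>'"
      using srl_subseries[OF Suc.prems(1) p _ U(2)] U(5) 1 by metis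
    have "slopes_above G \<Sigma> p ?t d = slopes_above G \<Sigma>' p ?t d"
      using U(1,4) \<Sigma>'(2) slopes_above_mono[OF \<Sigma>'(1)] unfolding slopes_above_def by blast
    then show ?thesis using Suc.IH[OF \<Sigma>'(3)] U(3) \<Sigma>'(2) by auto
  next
    case 2
    text \<open>Here \<open>f\<close> has the smallest slope of \<open>\<Sigma>\<close> in every direction at \<open>p\<close>, so it is compared
      with a function provided by condition (1) for the divisor \<open>k p\<close>.\<close>
    have "{i \<in> {..<k}. p = p} = {..<k}" by auto
    then obtain h where h: "h \<in> \<Sigma>" "of_int (D p) + divf G h p \<ge> real k"
      using tls_exists[of G D "{..<k}" \<Sigma> "\<lambda>_. p"] tls p by fastforce
    have "divf G h p \<le> divf G f p"
      using slope_ge_if_slopes_above_full[OF G tls p d 2 h(1)] p by (simp add: divf_def sum_mono)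
    then show ?thesis using 2 h(2) by simp
  qed
qed

section \<open>Nonredundant points of meet-closed arrays\<close>

lemma leq_vec_iff: "leq_vec x y \<longleftrightarrow> length x = length y \<and> (\<forall>i<length x. x ! i \<le> y ! i)"
  by (auto simp: leq_vec_def list_all2_conv_all_nth)

lemma leq_vec_refl: "leq_vec x x"
  by (simp add: leq_vec_iff)

lemma leq_vec_trans: "leq_vec x y \<Longrightarrow> leq_vec y z \<Longrightarrow> leq_vec x z"
  by (fastforce simp: leq_vec_iff)

lemma leq_vec_sum_list_less:
  assumes "leq_vec x y" "x \<noteq> y"
  shows "sum_list x < sum_list y"
proof -
  have "sum_list x \<le> sum_list y \<and> (x \<noteq> y \<longrightarrow> sum_list x < sum_list y)"
    using assms(1) unfolding leq_vec_def by (induction rule: list_all2_induct) auto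
  then show ?thesis using assms(2) by blast
qed

lemma finite_cube: "finite (cube r d)"
  using finite_lists_length_eq[of "{0..r}" d] by (simp add: cube_def conj_commute)

lemma cube_nth: "x \<in> cube r d \<Longrightarrow> i < d \<Longrightarrow> x ! i \<le> r"
  by (force simp: cube_def in_set_conv_nth)

lemma vmin_cube:
  assumes "S \<subseteq> cube r d" "S \<noteq> {}"
  shows "length (vmin S) = d" "i < d \<Longrightarrow> vmin S ! i = Min ((\<lambda>y. y ! i) ` S)"
proof -
  have "(SOME y. y \<in> S) \<in> S" using assms(2) some_in_eq by blast
  then have "length (SOME y. y \<in> S) = d" using assms(1) by (auto simp: cube_def)
  then show "length (vmin S) = d" "i < d \<Longrightarrow> vmin S ! i = Min ((\<lambda>y. y ! i) ` S)"
    by (auto simp: vmin_def)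
qed

text \<open>Redundancy tested one coordinate at a time: each coordinate of \<open>x\<close> needs a
  strictly larger point of \<open>P\<close> that agrees with \<open>x\<close> there. Conversely, one
  such witness per coordinate forms the set whose minimum is \<open>x\<close>.\<close>

lemma redundant_iff:
  assumes "0 < d" and P: "P \<subseteq> cube r d" and x: "x \<in> cube r d"
  shows "redundant d P x \<longleftrightarrow> (\<forall>i<d. \<exists>y\<in>P. leq_vec x y \<and> y \<noteq> x \<and> y ! i = x ! i)"
proof
  assume "redundant d P x"
  then obtain S where S: "S \<subseteq> P" "finite S" "card S \<ge> 2" "x \<notin> S" "vmin S = x"
    unfolding redundant_def by blast
  have ne: "S \<noteq> {}" using S(3) by auto
  have SP: "S \<subseteq> cube r d" using S P by blast
  have xi: "x ! i = Min ((\<lambda>y. y ! i) ` S)" if "i < d" for i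
    using vmin_cube(2)[OF SP ne that] S(5) by simp
  have le: "leq_vec x y" if "y \<in> S" for y
    using that SP x S(2) by (auto simp: leq_vec_iff cube_def xi)
  show "\<forall>i<d. \<exists>y\<in>P. leq_vec x y \<and> y \<noteq> x \<and> y ! i = x ! i"
  proof (intro allI impI)
    fix i assume "i < d"
    have "x ! i \<in> (\<lambda>y. y ! i) ` S" unfolding xi[OF \<open>i < d\<close>] using S(2) ne by (intro Min_in) auto
    then obtain y where "y \<in> S" "x ! i = y ! i" by (rule imageE)
    then show "\<exists>y\<in>P. leq_vec x y \<and> y \<noteq> x \<and> y ! i = x ! i"
      using S(1,4) le by (intro bexI[of _ y]) auto
  qed
next
  assume "\<forall>i<d. \<exists>y\<in>P. leq_vec x y \<and> y \<noteq> x \<and> y ! i = x ! i"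
  then obtain Y where Y: "\<And>i. i < d \<Longrightarrow> Y i \<in> P \<and> leq_vec x (Y i) \<and> Y i \<noteq> x \<and> Y i ! i = x ! i" by metis
  define S where "S = Y ` {..<d}"
  have ne: "S \<noteq> {}" and fin: "finite S" using assms(1) by (auto simp: S_def)
  have S: "S \<subseteq> P" "x \<notin> S" using Y by (auto simp: S_def)
  have SP: "S \<subseteq> cube r d" using S P by blast
  have lenx: "length x = d" using x by (simp add: cube_def)
  have vmin: "vmin S = x"
  proof (rule nth_equalityI)
    show "length (vmin S) = length x" using vmin_cube(1)[OF SP ne] lenx by simp
    fix i assume "i < length (vmin S)"
    then have i: "i < d" using vmin_cube(1)[OF SP ne] by simp
    have "Min ((\<lambda>y. y ! i) ` S) = x ! i"
    proof (rule Min_eqI)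
      show "finite ((\<lambda>y. y ! i) ` S)" using fin by simp
      show "x ! i \<le> n" if "n \<in> (\<lambda>y. y ! i) ` S" for n
        using that Y i lenx by (auto simp: S_def leq_vec_iff)
      have "Y i \<in> S" using i by (simp add: S_def)
      then have "Y i ! i \<in> (\<lambda>y. y ! i) ` S" by (rule imageI)
      then show "x ! i \<in> (\<lambda>y. y ! i) ` S" using Y[OF i] by simp
    qed
    then show "vmin S ! i = x ! i" using vmin_cube(2)[OF SP ne i] by simp
  qed
  \<comment> \<open>A one-point set is its own minimum, so its element would be
    \<open>x\<close>.\<close>
  have "card S \<noteq> 1"
  proof
    assume "card S = 1"
    then obtain y where y: "S = {y}" by (auto simp: card_1_singleton_iff)
    have "y = x"
    proof (rule nth_equalityI)
      show "length y = length x" using y SP lenx by (simp add: cube_def)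
      fix i assume "i < length y"
      then have "i < d" using y SP by (simp add: cube_def)
      then show "y ! i = x ! i" using vmin_cube(2)[OF SP ne] vmin y by simp
    qed
    then show False using S(2) y by simp
  qed
  moreover have "card S \<noteq> 0" using ne fin by simp
  ultimately have "card S \<ge> 2" by simp
  moreover have "\<exists>i<d. y ! i = x ! i" if "y \<in> S" for y using that Y by (auto simp: S_def)
  ultimately show "redundant d P x" unfolding redundant_def using S fin vmin by blast
qed

text \<open>Abstract form of a local array \<open>M_v\<close>: minima of functions give closure
  under coordinatewise minima. Here \<open>P_v\<close> is identified as the set of nonredundant
  points.\<close>

locale meet_closed_array =
  fixes r d :: nat and M :: "nat list set"
  assumes d: "0 < d" and M: "M \<subseteq> cube r d"
    and vmin_closed: "\<And>S. S \<subseteq> M \<Longrightarrow> finite S \<Longrightarrow> S \<noteq> {} \<Longrightarrow> vmin S \<in> M"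
begin

definition core :: "nat list set" where
  "core = {x\<in>M. \<not> redundant d M x}"

lemma core_subset: "core \<subseteq> M"
  by (auto simp: core_def)

lemma core_cube: "core \<subseteq> cube r d"
  using core_subset M by blast

text \<open>Among the points above \<open>y\<close> with the same \<open>i\<close>-th coordinate,
  one of maximal coordinate sum cannot be redundant. Hence passing to \<open>core\<close> loses no
  coordinate value of any upset.\<close>

lemma core_above:
  assumes "y \<in> M" "i < d"
  shows "\<exists>z\<in>core. leq_vec y z \<and> z ! i = y ! i"
proof -
  define Z where "Z = {z\<in>M. leq_vec y z \<and> z ! i = y ! i}"
  have "finite Z" using M finite_cube finite_subset by (fastforce simp: Z_def)
  moreover have "y \<in> Z" using assms by (simp add: Z_def leq_vec_refl)
  ultimately have "Max (sum_list ` Z) \<in> sum_list ` Z" by (intro Max_in) auto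
  then obtain z where z: "z \<in> Z" "Max (sum_list ` Z) = sum_list z" by (rule imageE)
  have max: "sum_list w \<le> sum_list z" if "w \<in> Z" for w
    unfolding z(2)[symmetric] using \<open>finite Z\<close> that by simp
  have "z \<in> M" using z(1) by (simp add: Z_def)
  have "\<not> redundant d M z"
  proof
    assume "redundant d M z"
    then obtain w where w: "w \<in> M" "leq_vec z w" "w \<noteq> z" "w ! i = z ! i"
      using redundant_iff[OF d M] \<open>z \<in> M\<close> M assms(2) by blast
    then have "w \<in> Z" using z(1) leq_vec_trans by (fastforce simp: Z_def)
    with max leq_vec_sum_list_less[OF w(2)] w(3) show False by fastforce
  qed
  then show ?thesis using z(1) by (auto simp: core_def Z_def)
qed

text \<open>A witness in \<open>M\<close> is moved up to \<open>core\<close> by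
  \<open>core_above\<close>, keeping the relevant coordinate; it stays different from
  \<open>x\<close> because it only moves upwards.\<close>

lemma redundant_core_iff:
  assumes "x \<in> cube r d"
  shows "redundant d core x \<longleftrightarrow> redundant d M x"
  unfolding redundant_iff[OF d core_cube assms] redundant_iff[OF d M assms]
proof (intro iffI allI impI)
  fix i assume i: "i < d" and "\<forall>i<d. \<exists>y\<in>M. leq_vec x y \<and> y \<noteq> x \<and> y ! i = x ! i"
  then obtain y where y: "y \<in> M" "leq_vec x y" "y \<noteq> x" "y ! i = x ! i" by blast
  obtain z where z: "z \<in> core" "leq_vec y z" "z ! i = y ! i" using core_above[OF y(1) i] by blast
  have "z \<noteq> x"
    using y(2,3) z(2) leq_vec_sum_list_less[of x y] leq_vec_sum_list_less[of y z] by fastforce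
  then show "\<exists>y\<in>core. leq_vec x y \<and> y \<noteq> x \<and> y ! i = x ! i"
    using z y leq_vec_trans by metis
qed (use core_subset in blast)

lemma redundant_imp_mem: "x \<in> cube r d \<Longrightarrow> redundant d M x \<Longrightarrow> x \<in> M"
  unfolding redundant_def using vmin_closed by (metis card.empty not_numeral_le_zero)

lemma closure_core: "closure_arr r d core = M"
  using redundant_core_iff redundant_imp_mem core_subset M
  by (auto simp: closure_arr_def) (auto simp: core_def)

lemma upset_core_image:
  assumes "i < d"
  shows "(\<lambda>y. y ! i) ` upset core x = (\<lambda>y. y ! i) ` upset M x"
proof
  show "(\<lambda>y. y ! i) ` upset core x \<subseteq> (\<lambda>y. y ! i) ` upset M x"
    using core_subset by (auto simp: upset_def)
  show "(\<lambda>y. y ! i) ` upset M x \<subseteq> (\<lambda>y. y ! i) ` upset core x"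
  proof
    fix n assume "n \<in> (\<lambda>y. y ! i) ` upset M x"
    then obtain y where y: "n = y ! i" "y \<in> M" "leq_vec x y" by (auto simp: upset_def)
    obtain z where "z \<in> core" "leq_vec y z" "z ! i = y ! i"
      using core_above[OF y(2) assms] by blast
    then have "z \<in> upset core x" "z ! i = n" using y leq_vec_trans by (auto simp: upset_def)
    then show "n \<in> (\<lambda>y. y ! i) ` upset core x" by force
  qed
qed

lemma rankable_core: "rankable d (upset core x) s \<longleftrightarrow> rankable d (upset M x) s"
  unfolding rankable_def using upset_core_image by simp

text \<open>Redundancy over \<open>P\<close> and over \<open>M\<close> coincide: a witness that is
  itself redundant over \<open>P\<close> is replaced by a point of \<open>P\<close> above it with
  the same coordinate. Thus \<open>P\<close> must be the nonredundant part of
  \<open>M\<close>.\<close>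

lemma closure_eq_imp_core:
  assumes P: "perm_array r d P" "closure_arr r d P = M"
  shows "P = core"
proof -
  have Pc: "P \<subseteq> cube r d" and PM: "P \<subseteq> M" and nr: "\<And>x. x \<in> P \<Longrightarrow> \<not> redundant d P x"
    using P by (auto simp: perm_array_def closure_arr_def)
  have red: "redundant d P x" if x: "x \<in> cube r d" "redundant d M x" for x
    unfolding redundant_iff[OF d Pc x(1)]
  proof (intro allI impI)
    fix i assume i: "i < d"
    then obtain y where y: "y \<in> M" "leq_vec x y" "y \<noteq> x" "y ! i = x ! i"
      using x(2)[unfolded redundant_iff[OF d M x(1)]] by blast
    have "y \<in> P \<or> redundant d P y" using y(1) P(2) by (auto simp: closure_arr_def)
    then obtain z where z: "z \<in> P" "leq_vec y z" "z ! i = y ! i"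
      using redundant_iff[OF d Pc, of y] y(1) M i leq_vec_refl by blast
    have "z \<noteq> x"
      using y(2,3) z(2) leq_vec_sum_list_less[of x y] leq_vec_sum_list_less[of y z] by fastforce
    then show "\<exists>y\<in>P. leq_vec x y \<and> y \<noteq> x \<and> y ! i = x ! i"
      using z y leq_vec_trans by metis
  qed
  have mono: "redundant d M x" if "redundant d P x" for x
    using that PM unfolding redundant_def by blast
  have "x \<in> P \<longleftrightarrow> x \<in> core" for x
  proof
    assume "x \<in> P" then show "x \<in> core" using nr red PM Pc unfolding core_def by blast
  next
    assume "x \<in> core"
    then have "x \<in> closure_arr r d P" "\<not> redundant d P x" using P(2) mono by (auto simp: core_def)
    then show "x \<in> P" by (simp add: closure_arr_def)
  qed
  then show ?thesis by blast
qed

lemma arr_rank_eq: "rankable d P s \<Longrightarrow> arr_rank d P = s"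
  unfolding arr_rank_def rankable_def using d by (intro the_equality) auto

lemma the_perm_array:
  assumes "totally_rankable r d M" "\<And>i. i < d \<Longrightarrow> card ((\<lambda>y. y ! i) ` M) = r + 1"
  shows "(THE P. perm_array r d P \<and> M = closure_arr r d P) = core"
proof (rule the_equality)
  \<comment> \<open>The zero vector lies below the whole cube, so statements about upsets specialise
    to the full arrays.\<close>
  have "upset M (replicate d 0) = M" "upset core (replicate d 0) = core"
    using M core_cube by (auto simp: upset_def leq_vec_iff cube_def)
  then have "(\<lambda>y. y ! i) ` core = (\<lambda>y. y ! i) ` M" if "i < d" for i
    using upset_core_image[OF that, of "replicate d 0"] by simp
  then have "arr_rank d core = int r"
    using assms(2) by (intro arr_rank_eq) (simp add: rankable_def)
  then show "perm_array r d core \<and> M = closure_arr r d core"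
    using assms(1) closure_core core_cube redundant_core_iff
    unfolding perm_array_def totally_rankable_def rankable_core by (auto simp: core_def)
qed (use closure_eq_imp_core in auto)

end

section \<open>Local rank\<close>

locale series_at =
  fixes G :: "('v, 'e) mgraph" and D :: "('v, 'e) point \<Rightarrow> int"
    and \<Sigma> :: "(('v, 'e) point \<Rightarrow> real) set" and r :: nat
    and ord :: "('v, 'e) point \<Rightarrow> 'e tdir list" and p :: "('v, 'e) point"
  assumes G: "metric_graph G" and D: "divisor G D" and srl: "srl G D (Suc r) (Suc r) \<Sigma>"
    and p: "p \<in> pts G" and ord: "distinct (ord p)" "set (ord p) = tdirs G p"
    and tdirs: "tdirs G p \<noteq> {}"
begin

abbreviation val :: nat where "val \<equiv> length (ord p)"
abbreviation slp :: "nat \<Rightarrow> real list" where "slp i \<equiv> slopes G \<Sigma> (ord p ! i)"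
abbreviation arr :: "nat list set" where "arr \<equiv> local_array G \<Sigma> r ord p"

lemma tls: "tls G D (int r) \<Sigma>"
  by (rule srl_tls[OF srl])

lemma val_pos: "0 < val"
  using ord(2) tdirs by auto

lemma valence_eq: "valence G p = val"
  using ord distinct_card by (fastforce simp: valence_def)

lemma ord_tdirs: "i < val \<Longrightarrow> ord p ! i \<in> tdirs G p"
  using ord(2) nth_mem by blast

lemma tdirs_ord: "(\<forall>e\<in>tdirs G p. Q e) \<longleftrightarrow> (\<forall>i<val. Q (ord p ! i))"
  unfolding ord(2)[symmetric] by (simp add: all_set_conv_all_nth)

lemma tdir_at_ord: "i < val \<Longrightarrow> tdir_at G p (ord p ! i)"
  using G p ord_tdirs by unfold_locales auto

lemma slp:
  assumes "i < val"
  shows "set (slp i) = (\<lambda>f. sl G f (ord p ! i)) ` \<Sigma>" "length (slp i) = r + 1" "sorted_wrt (<) (slp i)"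
proof -
  interpret tdir_at G p "ord p ! i" by (rule tdir_at_ord[OF assms])
  show "set (slp i) = (\<lambda>f. sl G f (ord p ! i)) ` \<Sigma>" "length (slp i) = r + 1"
    using tls_finite_slopes(1)[OF tls] tls_card_slopes[OF tls D] by (simp_all add: slopes_def)
  show "sorted_wrt (<) (slp i)" by (simp add: slopes_def)
qed

lemma slp_le_iff: "i < val \<Longrightarrow> a \<le> r \<Longrightarrow> b \<le> r \<Longrightarrow> slp i ! a \<le> slp i ! b \<longleftrightarrow> a \<le> b"
  using slp(2,3)[of i] sorted_wrt_nth_less[of "(<)" "slp i" a b] sorted_wrt_nth_less[of "(<)" "slp i" b a]
  by (cases a b rule: linorder_cases) auto

lemma slp_inj: "i < val \<Longrightarrow> inj_on ((!) (slp i)) {0..r}"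
  using slp_le_iff by (intro inj_onI) (metis atLeastAtMost_iff order.eq_iff)

lemma ex_assoc:
  assumes "f \<in> \<Sigma>"
  shows "\<exists>x. assoc G \<Sigma> r ord p x f"
proof -
  have "\<exists>n\<le>r. slp i ! n = sl G f (ord p ! i)" if "i < val" for i
  proof -
    have "sl G f (ord p ! i) \<in> set (slp i)" using slp(1)[OF that] assms by blast
    then show ?thesis using slp(2)[OF that] by (auto simp: in_set_conv_nth less_Suc_eq_le)
  qed
  then obtain n where n: "\<And>i. i < val \<Longrightarrow> n i \<le> r \<and> slp i ! n i = sl G f (ord p ! i)" by metis
  have "assoc G \<Sigma> r ord p (map n [0..<val]) f"
    using n assms by (auto simp: assoc_def cube_def)
  then show ?thesis ..
qed

lemma assoc_unique:
  assumes "assoc G \<Sigma> r ord p x f" "assoc G \<Sigma> r ord p y f"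
  shows "x = y"
proof (rule nth_equalityI)
  show "length x = length y" using assms by (simp add: assoc_def cube_def)
  fix i assume "i < length x"
  then have i: "i < val" using assms by (simp add: assoc_def cube_def)
  have "slp i ! (x ! i) = slp i ! (y ! i)" using assms i by (simp add: assoc_def)
  moreover have "x ! i \<le> r" "y ! i \<le> r" using assms i cube_nth by (auto simp: assoc_def)
  ultimately show "x ! i = y ! i" using slp_inj[OF i] by (auto dest: inj_onD)
qed

lemma arr_cube: "arr \<subseteq> cube r val"
  by (auto simp: local_array_def assoc_def)

text \<open>Functions shifted to vanish at \<open>p\<close> all attain the minimum there, so in each
  direction the slope of their minimum is the least of their slopes.\<close>

lemma arr_vmin:
  assumes S: "S \<subseteq> arr" "finite S" "S \<noteq> {}"
  shows "vmin S \<in> arr"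
proof -
  have SC: "S \<subseteq> cube r val" using S(1) arr_cube by blast
  obtain \<phi> where \<phi>: "\<And>x. x \<in> S \<Longrightarrow> assoc G \<Sigma> r ord p x (\<phi> x)"
  proof -
    have "\<forall>x\<in>S. \<exists>f. assoc G \<Sigma> r ord p x f" using S(1) by (auto simp: local_array_def)
    from bchoice[OF this] show thesis using that by blast
  qed
  define F where "F = \<phi> ` S"
  have F: "finite F" "F \<noteq> {}" "F \<subseteq> \<Sigma>"
    using S \<phi> by (auto simp: F_def assoc_def)
  have pl: "pl_fun G g" if "g \<in> F" for g using F(3) that tls_pl[OF tls] by blast
  define f where "f = tmin G F (\<lambda>g. - g p)"
  have act: "active F (\<lambda>g. - g p) p = F" by (auto simp: active_def)
  have "f \<in> \<Sigma>" unfolding f_def by (rule fg_module_tmin[OF tls_fg[OF tls] F])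
  have "sl G f (ord p ! i) = slp i ! (vmin S ! i)" and "vmin S ! i \<le> r" if i: "i < val" for i
  proof -
    interpret tdir_at G p "ord p ! i" by (rule tdir_at_ord[OF i])
    have v: "vmin S ! i = Min ((\<lambda>y. y ! i) ` S)" by (rule vmin_cube(2)[OF SC S(3) i])
    have "Min ((\<lambda>y. y ! i) ` S) \<in> (\<lambda>y. y ! i) ` S" using S(2,3) by (intro Min_in) auto
    then obtain x where x: "x \<in> S" "Min ((\<lambda>y. y ! i) ` S) = x ! i" by (rule imageE)
    have min: "x ! i \<le> y ! i" if "y \<in> S" for y
      unfolding x(2)[symmetric] using S(2) that by simp
    have r: "y ! i \<le> r" if "y \<in> S" for y using that SC i cube_nth by blast
    have sl: "sl G (\<phi> y) (ord p ! i) = slp i ! (y ! i)" if "y \<in> S" for y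
      using \<phi>[OF that] i by (simp add: assoc_def)
    have "sl G (\<phi> x) (ord p ! i) \<le> sl G g (ord p ! i)" if "g \<in> F" for g
    proof -
      obtain y where "y \<in> S" "g = \<phi> y" using \<open>g \<in> F\<close> unfolding F_def by blast
      then show ?thesis using sl x(1) min r slp_le_iff[OF i] by simp
    qed
    then have "sl G f (ord p ! i) = sl G (\<phi> x) (ord p ! i)"
      unfolding f_def using imageI[OF x(1), of \<phi>]
      by (intro sl_tmin F pl) (simp_all add: act F_def[symmetric])
    then show "sl G f (ord p ! i) = slp i ! (vmin S ! i)" using sl x v by simp
    show "vmin S ! i \<le> r" using v x r by simp
  qed
  then have "assoc G \<Sigma> r ord p (vmin S) f"
    using \<open>f \<in> \<Sigma>\<close> vmin_cube(1)[OF SC S(3)] by (auto simp: assoc_def cube_def in_set_conv_nth)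
  then show ?thesis by (auto simp: local_array_def)
qed

sublocale meet_closed_array r val arr
  using val_pos arr_cube arr_vmin by unfold_locales auto

text \<open>Dictionary between the two languages: slope lists are strictly increasing, so dominating
  \<open>t\<close> in all directions means lying above \<open>x\<close> in the array.\<close>

lemma slopes_above_eq_upset:
  assumes x: "x \<in> cube r val" and t: "\<And>i. i < val \<Longrightarrow> t (ord p ! i) = slp i ! (x ! i)" and i: "i < val"
  shows "slopes_above G \<Sigma> p t (ord p ! i) = (!) (slp i) ` (\<lambda>y. y ! i) ` upset arr x"
proof -
  have above: "(\<forall>e\<in>tdirs G p. t e \<le> sl G f e) \<longleftrightarrow> leq_vec x y" if y: "assoc G \<Sigma> r ord p y f" for f y
  proof -
    have "t (ord p ! j) \<le> sl G f (ord p ! j) \<longleftrightarrow> x ! j \<le> y ! j" if "j < val" for j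
      using that t y x slp_le_iff cube_nth by (auto simp: assoc_def)
    then show ?thesis
      unfolding tdirs_ord using x y by (auto simp: leq_vec_iff assoc_def cube_def)
  qed
  show ?thesis
  proof (intro set_eqI iffI)
    fix s assume "s \<in> slopes_above G \<Sigma> p t (ord p ! i)"
    then obtain f where f: "f \<in> \<Sigma>" "\<forall>e\<in>tdirs G p. t e \<le> sl G f e" "s = sl G f (ord p ! i)"
      by (auto simp: slopes_above_def)
    obtain y where y: "assoc G \<Sigma> r ord p y f" using ex_assoc[OF f(1)] ..
    then have "y \<in> upset arr x" using above f(2) by (auto simp: upset_def local_array_def)
    moreover have "s = slp i ! (y ! i)" using y f(3) i by (simp add: assoc_def)
    ultimately show "s \<in> (!) (slp i) ` (\<lambda>y. y ! i) ` upset arr x" by blast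
  next
    fix s assume "s \<in> (!) (slp i) ` (\<lambda>y. y ! i) ` upset arr x"
    then obtain y f where y: "s = slp i ! (y ! i)" "leq_vec x y" "assoc G \<Sigma> r ord p y f"
      by (auto simp: upset_def local_array_def)
    then have "f \<in> \<Sigma>" "sl G f (ord p ! i) = s" using i by (auto simp: assoc_def)
    moreover have "\<forall>e\<in>tdirs G p. t e \<le> sl G f e" using above[OF y(3)] y(2) by blast
    ultimately show "s \<in> slopes_above G \<Sigma> p t (ord p ! i)"
      by (auto simp: slopes_above_def)
  qed
qed

text \<open>Independence of the slope count from the direction is exactly rankability; the shift by
  1 turns a number of values into a rank.\<close>

lemma rankable_upset:
  assumes x: "x \<in> cube r val" and t: "\<And>i. i < val \<Longrightarrow> t (ord p ! i) = slp i ! (x ! i)"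
    and d: "d \<in> tdirs G p"
  shows "rankable val (upset arr x) (int (card (slopes_above G \<Sigma> p t d)) - 1)"
  unfolding rankable_def
proof (intro allI impI)
  fix i assume i: "i < val"
  have "(\<lambda>y. y ! i) ` upset arr x \<subseteq> {0..r}"
    using arr_cube cube_nth i by (auto simp: upset_def)
  moreover have "slopes_above G \<Sigma> p t (ord p ! i) = (!) (slp i) ` (\<lambda>y. y ! i) ` upset arr x"
    using x t i by (rule slopes_above_eq_upset)
  ultimately have "card ((\<lambda>y. y ! i) ` upset arr x) = card (slopes_above G \<Sigma> p t (ord p ! i))"
    by (simp only:) (intro card_image[symmetric] inj_on_subset[OF slp_inj[OF i]])
  also have "\<dots> = card (slopes_above G \<Sigma> p t d)"
    by (rule card_slopes_above_eq[OF G D p ord_tdirs[OF i] d srl])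
  finally show "int (card ((\<lambda>y. y ! i) ` upset arr x)) = int (card (slopes_above G \<Sigma> p t d)) - 1 + 1"
    by simp
qed

lemma totally_rankable_arr: "totally_rankable r val arr"
  unfolding totally_rankable_def
proof
  fix x assume x: "x \<in> cube r val"
  \<comment> \<open>\<open>x\<close> need not come from a function, so the slope bounds are read off
    directly from the slope lists, locating each direction by its position in
    \<open>ord p\<close>.\<close>
  define t where "t e = slopes G \<Sigma> e ! (x ! (THE i. i < val \<and> ord p ! i = e))" for e
  have "t (ord p ! i) = slp i ! (x ! i)" if "i < val" for i
  proof -
    have "(THE j. j < val \<and> ord p ! j = ord p ! i) = i"
      using that ord(1) by (intro the_equality) (auto simp: nth_eq_iff_index_eq)
    then show ?thesis by (simp add: t_def)
  qed
  from rankable_upset[OF x this ord_tdirs[OF val_pos]] show "\<exists>s. rankable val (upset arr x) s" ..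
qed

lemma card_arr_image:
  assumes i: "i < val"
  shows "card ((\<lambda>y. y ! i) ` arr) = r + 1"
proof -
  have "(\<lambda>y. y ! i) ` arr = {0..r}"
  proof
    show "(\<lambda>y. y ! i) ` arr \<subseteq> {0..r}" using arr_cube cube_nth i by auto
    show "{0..r} \<subseteq> (\<lambda>y. y ! i) ` arr"
    proof
      fix n assume "n \<in> {0..r}"
      then have "n \<le> r" by simp
      then have "slp i ! n \<in> set (slp i)" using slp(2)[OF i] by simp
      then obtain f where f: "f \<in> \<Sigma>" "sl G f (ord p ! i) = slp i ! n" using slp(1)[OF i] by auto
      obtain y where y: "assoc G \<Sigma> r ord p y f" using ex_assoc[OF f(1)] ..
      then have "slp i ! (y ! i) = slp i ! n" using i f(2) by (simp add: assoc_def)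
      moreover have "y ! i \<le> r" using y i cube_nth by (auto simp: assoc_def)
      ultimately have "y ! i = n" using slp_inj[OF i] \<open>n \<le> r\<close> by (auto dest: inj_onD)
      then show "n \<in> (\<lambda>y. y ! i) ` arr" using y by (force simp: local_array_def)
    qed
  qed
  then show ?thesis by simp
qed

lemma local_rank_eq:
  assumes f: "f \<in> \<Sigma>" and d: "d \<in> tdirs G p"
  shows "local_rank G \<Sigma> r ord p f = int (card (slopes_above G \<Sigma> p (sl G f) d)) - 1"
proof -
  obtain x where x: "assoc G \<Sigma> r ord p x f" using ex_assoc[OF f] ..
  then have the: "(THE x. assoc G \<Sigma> r ord p x f) = x" using assoc_unique by blast
  have "local_perm_array G \<Sigma> r ord p = core"
    unfolding local_perm_array_def valence_eq
    by (rule the_perm_array[OF totally_rankable_arr card_arr_image])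
  moreover have "rankable val (upset core x) (int (card (slopes_above G \<Sigma> p (sl G f) d)) - 1)"
    unfolding rankable_core using x d by (intro rankable_upset) (auto simp: assoc_def)
  ultimately show ?thesis
    unfolding local_rank_def rank_array_def valence_eq the by (simp add: arr_rank_eq)
qed

end

text \<open>A path from a vertex to the source of some edge is either trivial or begins with an edge
  at that vertex.\<close>

lemma tdirs_nonempty:
  assumes G: "metric_graph G" and "edges G \<noteq> {}" and p: "p \<in> pts G"
  shows "tdirs G p \<noteq> {}"
proof (cases p)
  case (Vtx v)
  then have v: "v \<in> verts G" using p by (auto simp: pts_def)
  obtain e where e: "e \<in> edges G" using assms(2) by blast
  have "src G e \<in> verts G" using G e by (simp add: metric_graph_def)
  then have "(v, src G e) \<in> ({(src G e, tgt G e) | e. e \<in> edges G} \<union> {(tgt G e, src G e) | e. e \<in> edges G})\<^sup>*"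
    using G v unfolding metric_graph_def by blast
  then have "\<exists>e\<in>edges G. src G e = v \<or> tgt G e = v"
    by (cases rule: converse_rtranclE) (use e in auto)
  then show ?thesis using Vtx by (auto simp: tdirs_def)
qed (simp add: tdirs_def)

theorem mainTheorem9:
  fixes G :: "('v, 'e) mgraph"
    and D E :: "('v, 'e) point \<Rightarrow> int"
    and \<Sigma> :: "(('v, 'e) point \<Rightarrow> real) set"
    and r :: nat
    and ord :: "('v, 'e) point \<Rightarrow> 'e tdir list"
  assumes "metric_graph G"
    and "edges G \<noteq> {}"
    and "divisor G D"
    and "strongly_recursive G D (int r) \<Sigma>"
    and "\<forall>p\<in>pts G. distinct (ord p) \<and> set (ord p) = tdirs G p"
    and "effective G E"
    and "deg E = int r"
  shows "\<exists>f\<in>\<Sigma>. (\<forall>p\<in>pts G. of_int (D p) + divf G f p \<ge> of_int (E p)) \<and>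
                (\<forall>p\<in>pts G. local_rank G \<Sigma> r ord p f \<ge> E p)"
proof -
  have srl: "srl G D (Suc r) (Suc r) \<Sigma>"
    using assms(4) by (simp add: strongly_recursive_def nat_add_distrib del: srl.simps)
  have tls: "tls G D (int r) \<Sigma>" by (rule srl_tls[OF srl])
  have series: "series_at G D \<Sigma> r ord p" if "p \<in> pts G" for p
    using assms(1,3) srl that bspec[OF assms(5) that] tdirs_nonempty[OF assms(1,2) that]
    by (intro series_at.intro) blast+
  \<comment> \<open>Any direction will do, because \<open>local_rank_eq\<close> holds along each of
    them.\<close>
  define \<eta> where "\<eta> p = (SOME d. d \<in> tdirs G p)" for p
  have \<eta>: "\<eta> p \<in> tdirs G p" if "p \<in> pts G" for p
    unfolding \<eta>_def using tdirs_nonempty[OF assms(1,2) that] some_in_eq by blast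
  have E: "finite {p. E p \<noteq> 0}" "{p. E p \<noteq> 0} \<subseteq> pts G" "\<And>p. E p \<ge> 0"
    using assms(6) by (auto simp: effective_def divisor_def)
  obtain p0 where p0: "p0 \<in> pts G"
    using assms(1) by (auto simp: metric_graph_def pts_def)
  \<comment> \<open>The point \<open>p0\<close> keeps \<open>V\<close> nonempty when
    \<open>E = 0\<close>, as \<open>tls_exists_spread\<close> requires.\<close>
  define V where "V = insert p0 {p. E p \<noteq> 0}"
  have V: "finite V" "V \<subseteq> pts G" "V \<noteq> {}" using E p0 by (auto simp: V_def)
  have "int (\<Sum>p\<in>V. nat (E p)) = (\<Sum>p\<in>V. E p)" using E(3) by simp
  also have "\<dots> = deg E"
    unfolding deg_def using V(1) by (intro sum.mono_neutral_right) (auto simp: V_def)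
  finally have "(\<Sum>p\<in>V. nat (E p)) = r" using assms(7) by (simp only: of_nat_eq_iff)
  then obtain f where f: "f \<in> \<Sigma>" and fV: "\<And>p. p \<in> V \<Longrightarrow> nat (E p) < card (slopes_above G \<Sigma> p (sl G f) (\<eta> p))"
    using tls_exists_spread[OF assms(1,3) tls V, of "\<lambda>p. nat (E p)" \<eta>] \<eta> V(2) by blast
  have card: "E p + 1 \<le> int (card (slopes_above G \<Sigma> p (sl G f) (\<eta> p)))" if p: "p \<in> pts G" for p
  proof (cases "p \<in> V")
    case True
    then show ?thesis using fV[OF True] E(3)[of p] by linarith
  next
    case False
    interpret tdir_at G p "\<eta> p" using assms(1) p \<eta>[OF p] by unfold_locales
    \<comment> \<open>Outside \<open>V\<close> the value of \<open>E\<close> is 0, and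
      \<open>f\<close> dominates itself.\<close>
    have "slopes_above G \<Sigma> p (sl G f) (\<eta> p) \<noteq> {}"
      using f by (auto simp: slopes_above_def)
    moreover have "finite (slopes_above G \<Sigma> p (sl G f) (\<eta> p))"
      by (rule finite_subset[OF slopes_above_subset tls_finite_slopes(1)[OF tls]])
    ultimately have "card (slopes_above G \<Sigma> p (sl G f) (\<eta> p)) > 0" by (simp add: card_gt_0_iff)
    moreover have "E p = 0" using False by (simp add: V_def)
    ultimately show ?thesis by simp
  qed
  show ?thesis
  proof (intro bexI[OF _ f] conjI ballI)
    fix p assume p: "p \<in> pts G"
    have "of_int (E p + 1) \<le> (of_int (int (card (slopes_above G \<Sigma> p (sl G f) (\<eta> p)))) :: real)"
      using card[OF p] by (simp only: of_int_le_iff)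
    then show "of_int (E p) \<le> of_int (D p) + divf G f p"
      using divf_ge_card_slopes_above[OF assms(1,3) p \<eta>[OF p] srl f] by simp
    show "E p \<le> local_rank G \<Sigma> r ord p f"
      using card[OF p] series_at.local_rank_eq[OF series[OF p] f \<eta>[OF p]] by simp
  qed
qed

end
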